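(* Consider the opinion dynamics on $\mathbb{R}^{N_a}$ $$\dot x_i = -d\,x_i + u\,S\Big(\alpha x_i + \gamma \sum_{k=1,\,k\neq i}^{N_a} \bar a_{ik} x_k\Big),\qquad i=1,\dots,N_a,$$ with $d>0$, $\alpha\ge 0$, $u\ge 0$, and $\bar A=(\bar a_{ik})$ the $0/1$ adjacency matrix of an undirected, connected, $K$-regular graph $\bar G$ with vertex set $V=\{1,\dots,N_a\}$. Let $\lambda_{max},\lambda_{min}$ be the largest and smallest eigenvalues of $\bar A$ and let $\vartheta>0$ be a threshold. (i) If $\gamma>0$, the agreement bifurcation from $\mathbf{x}=\mathbf{0}$ at $u=u_a:=\frac{d}{\alpha+\gamma\lambda_{max}}$ gives rise to consensus solutions: agreement equilibria with $|x_i-x_k|<\vartheta$ for all $i,k\in V$. (ii) If $\gamma<0$, the disagreement bifurcation from $\mathbf{x}=\mathbf{0}$ at $u=u_d:=\frac{d}{\alpha+\gamma\lambda_{min}}$ gives rise to dissensus solutions: disagreement equilibria with $\left|\sum_{i=1}^{N_a}x_i\right|<\vartheta N_a$.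
   Context: Standing assumptions: $N_a\ge 2$; the graph has no self-loops; $\bar a_{ik}\in\{0,1\}$ with $\bar a_{ik}=1$ iff $(i,k)$ is an edge, so $\bar A$ is symmetric. A graph is $K$-regular if every vertex has exactly $K$ neighbors. $S:\mathbb{R}\to\mathbb{R}$ is an odd, saturating (bounded), twice continuously differentiable function with $S(0)=0$, $S'(0)=1$, and $\operatorname{sign}(S''(z))=-\operatorname{sign}(z)$ for all $z$. The agreement bifurcation ($\gamma>0$) at $u=u_a$ is the steady-state bifurcation at which branches of nonzero equilibria emerge from $\mathbf{x}=\mathbf{0}$ along (tangent to) the $\lambda_{max}$-eigenspace of $\bar A$; these are agreement equilibria, i.e. $x_i\ne0$ and $\operatorname{sign}(x_i)=\operatorname{sign}(x_k)$ for all $i,k\in V$. The disagreement bifurcation ($\gamma<0$) at $u=u_d$ is the steady-state bifurcation at which branches of nonzero equilibria emerge from $\mathbf{x}=\mathbf{0}$ along (tangent to) the $\lambda_{min}$-eigenspace of $\bar A$; these are disagreement equilibria, i.e. $\operatorname{sign}(x_i)=-\operatorname{sign}(x_k)\ne0$ for at least one pair $i,k$. "Gives rise to" is meant locally: the conclusion concerns the equilibria on the bifurcating branches with $(\mathbf{x},u)$ sufficiently close to the bifurcation point $(\mathbf{0},u_a)$, respectively $(\mathbf{0},u_d)$. *)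

theory Defs
  imports "HOL-Analysis.Analysis"
begin

definition simple_graph :: "('n \<Rightarrow> 'n \<Rightarrow> bool) \<Rightarrow> bool" where
  "simple_graph adj \<longleftrightarrow> symp adj \<and> irreflp adj"

definition connected_graph :: "('n \<Rightarrow> 'n \<Rightarrow> bool) \<Rightarrow> bool" where
  "connected_graph adj \<longleftrightarrow> (\<forall>i k. adj\<^sup>*\<^sup>* i k)"

definition regular_graph :: "nat \<Rightarrow> ('n::finite \<Rightarrow> 'n \<Rightarrow> bool) \<Rightarrow> bool" where
  "regular_graph K adj \<longleftrightarrow> (\<forall>i. card {k. adj i k} = K)"

definition adjacency_matrix :: "('n::finite \<Rightarrow> 'n \<Rightarrow> bool) \<Rightarrow> real^'n^'n" where
  "adjacency_matrix adj = (\<chi> i k. if adj i k then 1 else 0)"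

definition eigenspace :: "real^'n^'n \<Rightarrow> real \<Rightarrow> (real^'n) set" where
  "eigenspace A l = {v. A *v v = l *\<^sub>R v}"

definition eigenvalues :: "real^'n^'n \<Rightarrow> real set" where
  "eigenvalues A = {l. \<exists>v. v \<noteq> 0 \<and> A *v v = l *\<^sub>R v}"

definition lambda_max :: "real^'n^'n \<Rightarrow> real" where
  "lambda_max A = Max (eigenvalues A)"

definition lambda_min :: "real^'n^'n \<Rightarrow> real" where
  "lambda_min A = Min (eigenvalues A)"

definition odd_saturating :: "(real \<Rightarrow> real) \<Rightarrow> bool" where
  "odd_saturating S \<longleftrightarrow>
     (\<forall>z. S (- z) = - S z) \<and>
     bounded (range S) \<and>
     (\<forall>z. S differentiable (at z)) \<and>
     (\<forall>z. deriv S differentiable (at z)) \<and>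
     continuous_on UNIV (deriv (deriv S)) \<and>
     S 0 = 0 \<and> deriv S 0 = 1 \<and>
     (\<forall>z. sgn (deriv (deriv S) z) = - sgn z)"

definition opinion_field ::
  "real \<Rightarrow> real \<Rightarrow> real \<Rightarrow> (real \<Rightarrow> real) \<Rightarrow> real^'n^'n \<Rightarrow> real \<Rightarrow> real^'n \<Rightarrow> real^'n" where
  "opinion_field d \<alpha> \<gamma> S A u x =
     (\<chi> i. - d * x $ i + u * S (\<alpha> * x $ i + \<gamma> * (\<Sum>k\<in>UNIV - {i}. A $ i $ k * x $ k)))"

definition nonzero_equilibria ::
  "(real \<Rightarrow> real^'n \<Rightarrow> real^'n) \<Rightarrow> ((real^'n) \<times> real) set" where
  "nonzero_equilibria f = {(x, u). 0 \<le> u \<and> x \<noteq> 0 \<and> f u x = 0}"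

text \<open>
  A family \<open>(x s, u s)\<close>, with \<open>s > 0\<close> small, of nonzero equilibria that emanates from \<open>(0, u0)\<close> as
  \<open>s\<close> tends to \<open>0\<close>, tangentially to the subspace \<open>E\<close>: the distance of \<open>x s\<close> from \<open>E\<close> is of smaller
  order than the norm of \<open>x s\<close>.  Continuity in \<open>s\<close> is not part of the definition, so a property of
  all branches holds in particular for all continuous ones; it is asserted separately below.
\<close>

definition equilibrium_branch ::
  "(real \<Rightarrow> real^'n \<Rightarrow> real^'n) \<Rightarrow> real \<Rightarrow> (real^'n) set \<Rightarrow>
   (real \<Rightarrow> real^'n) \<Rightarrow> (real \<Rightarrow> real) \<Rightarrow> bool" where
  "equilibrium_branch f u0 E x u \<longleftrightarrow>
     (\<forall>\<^sub>F s in at_right 0. (x s, u s) \<in> nonzero_equilibria f) \<and>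
     (x \<longlongrightarrow> 0) (at_right 0) \<and>
     (u \<longlongrightarrow> u0) (at_right 0) \<and>
     ((\<lambda>s. infdist (x s) E / norm (x s)) \<longlongrightarrow> 0) (at_right 0)"

text \<open>
  Branches of nonzero equilibria emerge from the trivial one at \<open>u0\<close> along \<open>E\<close>: there is one over
  every \<open>u\<close> slightly above \<open>u0\<close>, and for a one-dimensional critical eigenspace a branch can be chosen
  as a continuous curve.  For a critical eigenspace of higher dimension and a merely twice
  continuously differentiable nonlinearity, variational bifurcation theory provides no continuous
  selection.
\<close>

definition steady_state_bifurcation ::
  "(real \<Rightarrow> real^'n \<Rightarrow> real^'n) \<Rightarrow> real \<Rightarrow> (real^'n) set \<Rightarrow> bool" where
  "steady_state_bifurcation f u0 E \<longleftrightarrow>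
     (\<forall>u\<ge>0. f u 0 = 0) \<and>
     (\<exists>x. equilibrium_branch f u0 E x (\<lambda>s. u0 + s)) \<and>
     (dim E = 1 \<longrightarrow>
       (\<exists>x u. equilibrium_branch f u0 E x u \<and>
          (\<forall>\<^sub>F s in at_right 0. isCont x s \<and> isCont u s)))"

definition agreement :: "real^'n \<Rightarrow> bool" where
  "agreement x \<longleftrightarrow> (\<forall>i k. x $ i \<noteq> 0 \<and> sgn (x $ i) = sgn (x $ k))"

definition disagreement :: "real^'n \<Rightarrow> bool" where
  "disagreement x \<longleftrightarrow> (\<exists>i k. sgn (x $ i) = - sgn (x $ k) \<and> sgn (x $ i) \<noteq> 0)"

definition consensus :: "real \<Rightarrow> real^'n \<Rightarrow> bool" where
  "consensus \<theta> x \<longleftrightarrow> agreement x \<and> (\<forall>i k. \<bar>x $ i - x $ k\<bar> < \<theta>)"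

definition dissensus :: "real \<Rightarrow> real^'n \<Rightarrow> bool" where
  "dissensus \<theta> x \<longleftrightarrow> disagreement x \<and> \<bar>\<Sum>i\<in>UNIV. x $ i\<bar> < \<theta> * real CARD('n)"

text \<open>
  The bifurcation at \<open>(0, u0)\<close> along \<open>E\<close> takes place, and the equilibria on every bifurcating branch
  have the property \<open>P\<close> sufficiently close to the bifurcation point.
\<close>

definition bifurcation_gives_rise_to ::
  "(real \<Rightarrow> real^'n \<Rightarrow> real^'n) \<Rightarrow> real \<Rightarrow> (real^'n) set \<Rightarrow> (real^'n \<Rightarrow> bool) \<Rightarrow> bool" where
  "bifurcation_gives_rise_to f u0 E P \<longleftrightarrow>
     steady_state_bifurcation f u0 E \<and>
     (\<forall>x u. equilibrium_branch f u0 E x u \<longrightarrow> (\<forall>\<^sub>F s in at_right 0. P (x s)))"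

end

theory Submission
  imports Defs
begin

text \<open>
  Put \<open>B = \<alpha> + \<gamma> A\<close> and let \<open>\<mu>\<close> be its largest eigenvalue, which is \<open>\<alpha> + \<gamma> \<lambda>\<close> with \<open>\<lambda>\<close> the largest or
  the smallest eigenvalue of \<open>A\<close> according to the sign of \<open>\<gamma>\<close>; equilibria solve \<open>d x = u S (B x)\<close>.
  Nonzero equilibria over \<open>u > d / \<mu>\<close> come from minimising an energy on a small ball: at \<open>u = d / \<mu>\<close> the
  origin is a strict minimum because \<open>S\<close> is strictly sublinear, and beyond it the energy is negative
  along the eigenvector, so the minimum over the ball is interior and nonzero.  Equilibria
  converging to the bifurcation point are automatically tangent to the eigenspace, since
  \<open>(\<mu> - B) x = o(x)\<close>.  For a simple eigenvalue a uniform contraction gives a continuous branch.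

  In a connected regular graph the top eigenvectors are the constant vectors, so tangency forces
  all opinions to have one sign; eigenvectors for the smallest (negative) eigenvalue are orthogonal
  to the constants, so tangency forces both signs to occur.
\<close>

section \<open>Fixed points and selections depending on a parameter\<close>

text \<open>Moving the parameter from \<open>s\<close> to \<open>t\<close> displaces the fixed point
  by at most twice the displacement of the single value \<open>T s (g s)\<close>, because the
  contraction absorbs half of the distance. Hence continuity in the parameter at each frozen point
  passes to the fixed-point curve.\<close>

lemma uniform_contraction_continuous_fixpoint:
  fixes T :: "real \<Rightarrow> 'a::complete_space \<Rightarrow> 'a"
  assumes "complete C" "C \<noteq> {}"
    and maps: "\<And>s w. s \<in> I \<Longrightarrow> w \<in> C \<Longrightarrow> T s w \<in> C"
    and contr: "\<And>s w z. s \<in> I \<Longrightarrow> w \<in> C \<Longrightarrow> z \<in> C \<Longrightarrow> dist (T s w) (T s z) \<le> (1/2) * dist w z"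
    and cont: "\<And>w. w \<in> C \<Longrightarrow> continuous_on I (\<lambda>s. T s w)"
  obtains g where "\<And>s. s \<in> I \<Longrightarrow> g s \<in> C \<and> T s (g s) = g s" "continuous_on I g"
proof -
  have "\<exists>!w. w \<in> C \<and> T s w = w" if "s \<in> I" for s
    using Banach_fix[of C "1/2" "T s"] assms that by auto
  then have "\<forall>s\<in>I. \<exists>w. w \<in> C \<and> T s w = w"
    by blast
  then obtain g where g: "\<And>s. s \<in> I \<Longrightarrow> g s \<in> C \<and> T s (g s) = g s"
    by metis
  have "continuous_on I g"
    unfolding continuous_on_def
  proof
    fix s assume s: "s \<in> I"
    have bound: "dist (g t) (g s) \<le> 2 * dist (T t (g s)) (T s (g s))" if "t \<in> I" for t
    proof -
      have "dist (g t) (g s) \<le> dist (T t (g t)) (T t (g s)) + dist (T t (g s)) (T s (g s))"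
        using g[OF that] g[OF s] by (metis dist_triangle)
      also have "dist (T t (g t)) (T t (g s)) \<le> (1/2) * dist (g t) (g s)"
        using contr g s that by blast
      finally show ?thesis by simp
    qed
    have "((\<lambda>t. T t (g s)) \<longlongrightarrow> T s (g s)) (at s within I)"
      using cont[of "g s"] g[OF s] s unfolding continuous_on_def by blast
    from tendsto_mult_right_zero[OF tendsto_dist_iff[THEN iffD1, OF this], of 2]
    have "((\<lambda>t. dist (g t) (g s)) \<longlongrightarrow> 0) (at s within I)"
      by (rule tendsto_sandwich[OF _ _ tendsto_const, rotated 2])
        (auto simp: eventually_at_filter bound)
    then show "(g \<longlongrightarrow> g s) (at s within I)"
      by (rule tendsto_dist_iff[THEN iffD2])
  qed
  with g show thesis by (rule that)
qed

text \<open>The range of admissible \<open>s\<close> may shrink with \<open>r\<close>, so no fixed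
  radius yields a family tending to 0. Selecting at each \<open>s\<close> a point of nearly minimal
  norm serves all radii at once.\<close>

lemma selection_tendsto_0:
  fixes P :: "real \<Rightarrow> 'a::real_normed_vector \<Rightarrow> bool"
  assumes "\<And>r. r > 0 \<Longrightarrow> \<forall>\<^sub>F s in at_right 0. \<exists>x. P s x \<and> norm x < r"
  obtains x where "\<forall>\<^sub>F s in at_right 0. P s (x s)" "(x \<longlongrightarrow> 0) (at_right 0)"
proof -
  \<comment> \<open>The infimum need not be attained; the slack \<open>s\<close> in the choice of
    \<open>x s\<close> vanishes in the limit.\<close>
  define m where "m s = Inf (norm ` {x. P s x})" for s
  define x where "x s = (SOME x. P s x \<and> norm x < m s + s)" for s
  have x: "P s (x s) \<and> norm (x s) < m s + s" if "s > 0" "\<exists>x. P s x" for s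
  proof -
    have "\<exists>y\<in>norm ` {x. P s x}. y < m s + s"
      unfolding m_def using that by (intro cInf_lessD) auto
    then show ?thesis
      unfolding x_def by (intro someI_ex[of "\<lambda>x. P s x \<and> norm x < m s + s"]) auto
  qed
  have m: "m s \<le> norm y" if "P s y" for s y
    unfolding m_def using that by (intro cInf_lower bdd_belowI[of _ 0]) auto
  have pos: "\<forall>\<^sub>F s::real in at_right 0. s > 0"
    by (simp add: eventually_at_right_less)
  show thesis
  proof
    show "\<forall>\<^sub>F s in at_right 0. P s (x s)"
      using assms[OF zero_less_one] pos by eventually_elim (use x in blast)
    show "(x \<longlongrightarrow> 0) (at_right 0)"
    proof (rule tendstoI)
      fix e :: real assume "e > 0"
      have "\<forall>\<^sub>F s in at_right 0. s < e / 2"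
        using \<open>e > 0\<close> by (intro eventually_at_rightI[of 0 "e / 2"]) auto
      moreover have "\<forall>\<^sub>F s in at_right 0. \<exists>x. P s x \<and> norm x < e / 2"
        by (rule assms) (use \<open>e > 0\<close> in simp)
      ultimately show "\<forall>\<^sub>F s in at_right 0. dist (x s) 0 < e"
        using pos by eventually_elim (use x m in \<open>simp, fastforce\<close>)
    qed
  qed
qed

section \<open>Extremal eigenvalues of symmetric matrices\<close>

definition symmetric_matrix :: "real^'n^'n \<Rightarrow> bool" where
  "symmetric_matrix A \<longleftrightarrow> transpose A = A"

lemma symmetric_matrix_inner:
  "symmetric_matrix A \<Longrightarrow> (A *v x) \<bullet> y = x \<bullet> (A *v y)"
  by (metis dot_lmul_matrix symmetric_matrix_def transpose_matrix_vector)

lemma subspace_eigenspace: "subspace (eigenspace A l)"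
  by (auto simp: subspace_def eigenspace_def matrix_vector_right_distrib
      matrix_vector_mult_scaleR algebra_simps)

text \<open>Eigenvectors of distinct eigenvalues are orthogonal, hence independent, so the dimension
  bounds their number. This gives \<open>Max\<close> and \<open>Min\<close> in the extremal
  eigenvalues their meaning.\<close>

lemma finite_eigenvalues:
  fixes A :: "real^'n^'n"
  assumes "symmetric_matrix A"
  shows "finite (eigenvalues A)"
proof -
  have "\<forall>l\<in>eigenvalues A. \<exists>v. v \<noteq> 0 \<and> A *v v = l *\<^sub>R v"
    by (simp add: eigenvalues_def)
  then obtain v where v: "\<And>l. l \<in> eigenvalues A \<Longrightarrow> v l \<noteq> 0 \<and> A *v v l = l *\<^sub>R v l"
    by metis
  have orth: "v l \<bullet> v m = 0" if "l \<in> eigenvalues A" "m \<in> eigenvalues A" "l \<noteq> m" for l m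
  proof -
    have "l * (v l \<bullet> v m) = m * (v l \<bullet> v m)"
      using symmetric_matrix_inner[OF assms, of "v l" "v m"] v that by simp
    with \<open>l \<noteq> m\<close> show ?thesis by simp
  qed
  have "inj_on v (eigenvalues A)"
    by (rule inj_onI) (metis orth v inner_eq_zero_iff)
  moreover have "independent (v ` eigenvalues A)"
    using v orth by (intro pairwise_orthogonal_independent) (auto simp: pairwise_def orthogonal_def)
  then have "finite (v ` eigenvalues A)"
    using independent_bound by blast
  ultimately show ?thesis
    using finite_imageD by blast
qed

text \<open>By compactness the quadratic form attains its minimum on the unit sphere; the minimiser
  is an eigenvector, and testing the form on any other eigenvector shows that its eigenvalue is not
  smaller.\<close>

lemma Rayleigh_min:
  fixes A :: "real^'n^'n"
  assumes "symmetric_matrix A"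
  shows "lambda_min A \<in> eigenvalues A" "lambda_min A * (x \<bullet> x) \<le> x \<bullet> (A *v x)"
proof -
  have "\<exists>z\<in>sphere 0 1. \<forall>y\<in>sphere 0 1. z \<bullet> (A *v z) \<le> y \<bullet> (A *v y)"
    by (rule continuous_attains_inf) (auto intro!: continuous_intros)
  then obtain z where z: "norm z = 1" and min: "\<And>y. norm y = 1 \<Longrightarrow> z \<bullet> (A *v z) \<le> y \<bullet> (A *v y)"
    by auto
  define m where "m = z \<bullet> (A *v z)"
  have zz: "z \<bullet> z = 1"
    using z by (simp add: norm_eq_1)
  have m_le: "m * (y \<bullet> y) \<le> y \<bullet> (A *v y)" for y
  proof (cases "y = 0")
    case False
    have "m \<le> (y /\<^sub>R norm y) \<bullet> (A *v (y /\<^sub>R norm y))"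
      unfolding m_def by (rule min) (use False in simp)
    also have "\<dots> = (y \<bullet> (A *v y)) / (y \<bullet> y)"
      by (simp add: matrix_vector_mult_scaleR dot_square_norm power2_eq_square divide_inverse mult_ac)
    finally show ?thesis
      using False by (simp add: field_simps)
  qed simp
  text \<open>The form \<open>A - m\<close> is positive semidefinite and vanishes at \<open>z\<close>, so \<open>z\<close> is in its kernel.\<close>
  have "A *v z - m *\<^sub>R z = 0"
  proof (rule ccontr)
    define w where "w = A *v z - m *\<^sub>R z"
    define q where "q = w \<bullet> (A *v w) - m * (w \<bullet> w)"
    assume "A *v z - m *\<^sub>R z \<noteq> 0"
    then have ww: "w \<bullet> w > 0" by (simp add: w_def)
    have "0 \<le> 2 * t * (w \<bullet> w) + t\<^sup>2 * q" for t
    proof -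
      have "0 \<le> (z + t *\<^sub>R w) \<bullet> (A *v (z + t *\<^sub>R w)) - m * ((z + t *\<^sub>R w) \<bullet> (z + t *\<^sub>R w))"
        using m_le by simp
      also have "\<dots> = 2 * t * (w \<bullet> (A *v z - m *\<^sub>R z)) + t\<^sup>2 * q"
        using symmetric_matrix_inner[OF assms, of z w] zz
        by (simp add: m_def q_def matrix_vector_right_distrib matrix_vector_mult_scaleR
            inner_add_left inner_add_right inner_diff_right inner_commute power2_eq_square algebra_simps)
      finally show ?thesis by (simp add: w_def)
    qed
    moreover have q0: "q \<ge> 0"
      using m_le[of w] by (simp add: q_def)
    \<comment> \<open>A negative \<open>t\<close> proportional to \<open>w \<bullet> w\<close> makes
      the linear term dominate; the \<open>+ 1\<close> keeps the denominator positive when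
      \<open>q = 0\<close>.\<close>
    ultimately have "0 \<le> 2 * (- (w \<bullet> w) / (q + 1)) * (w \<bullet> w) + (- (w \<bullet> w) / (q + 1))\<^sup>2 * q"
      by blast
    also have "\<dots> = (w \<bullet> w)\<^sup>2 * (- q - 2) / (q + 1)\<^sup>2"
      using q0 by (simp add: power2_eq_square divide_simps) (simp add: algebra_simps)
    also have "\<dots> < 0"
      using q0 ww by (simp add: divide_neg_pos mult_pos_neg)
    finally show False by simp
  qed
  then have "m \<in> eigenvalues A"
    using z by (auto simp: eigenvalues_def intro!: exI[of _ z])
  moreover have "m \<le> l" if l: "l \<in> eigenvalues A" for l
  proof -
    obtain y where "y \<noteq> 0" "A *v y = l *\<^sub>R y"
      using l by (auto simp: eigenvalues_def)
    with m_le[of y] show ?thesis by simp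
  qed
  ultimately have "lambda_min A = m"
    unfolding lambda_min_def using finite_eigenvalues[OF assms] by (intro Min_eqI) auto
  with \<open>m \<in> eigenvalues A\<close> m_le
  show "lambda_min A \<in> eigenvalues A" "lambda_min A * (x \<bullet> x) \<le> x \<bullet> (A *v x)"
    by auto
qed

lemma eigenvalues_uminus: "eigenvalues (- A) = uminus ` eigenvalues A"
proof -
  have *: "- A *v v = - (A *v v)" for v
    using matrix_vector_mult_diff_rdistrib[of 0 A v] by simp
  have "l \<in> eigenvalues (- A) \<longleftrightarrow> - l \<in> eigenvalues A" for l
    unfolding eigenvalues_def * by simp (metis minus_minus)
  moreover have "l \<in> uminus ` X \<longleftrightarrow> - l \<in> X" for l and X :: "real set"
    by force
  ultimately show ?thesis
    by blast
qed

text \<open>Passing to \<open>- A\<close> reflects the spectrum and reduces this to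
  \<open>Rayleigh_min\<close>.\<close>

lemma Rayleigh_max:
  fixes A :: "real^'n^'n"
  assumes "symmetric_matrix A"
  shows "lambda_max A \<in> eigenvalues A" "x \<bullet> (A *v x) \<le> lambda_max A * (x \<bullet> x)"
proof -
  have sym: "symmetric_matrix (- A)"
    using assms by (simp add: symmetric_matrix_def transpose_def vec_eq_iff)
  have *: "- A *v x = - (A *v x)"
    using matrix_vector_mult_diff_rdistrib[of 0 A x] by simp
  have "lambda_min (- A) = - lambda_max A"
    using Rayleigh_min(1)[OF sym] finite_eigenvalues[OF assms]
    unfolding lambda_min_def lambda_max_def eigenvalues_uminus
    by (subst minus_Max_eq_Min) auto
  with Rayleigh_min(1)[OF sym] Rayleigh_min(2)[OF sym, of x] *
  show "lambda_max A \<in> eigenvalues A" "x \<bullet> (A *v x) \<le> lambda_max A * (x \<bullet> x)"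
    by (auto simp: eigenvalues_uminus)
qed

text \<open>\<open>A - l\<close> is injective on the orthogonal complement of the eigenspace, hence
  bounded below there, and it annihilates the eigenspace component. A small residual therefore means
  closeness to the eigenspace.\<close>

lemma infdist_eigenspace_le:
  fixes A :: "real^'n^'n"
  obtains c where "c > 0" "\<And>x. c * infdist x (eigenspace A l) \<le> norm (A *v x - l *\<^sub>R x)"
proof -
  let ?E = "eigenspace A l" and ?f = "\<lambda>x. A *v x - l *\<^sub>R x"
  let ?P = "{z. \<forall>w\<in>?E. orthogonal z w}"
  have lin: "bounded_linear ?f"
    by (intro bounded_linear_sub matrix_vector_mul_bounded_linear bounded_linear_scaleR_right)
  have sub: "subspace ?P"
    by (auto simp: subspace_def orthogonal_def inner_add_left)
  have "\<exists>c>0. \<forall>x\<in>?P. norm (?f x) \<ge> c * norm x"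
  proof (rule injective_imp_isometric[OF closed_subspace[OF sub] sub lin], intro ballI impI)
    fix x assume x: "x \<in> ?P" "?f x = 0"
    then have "x \<in> ?E" by (simp add: eigenspace_def)
    with x show "x = 0" by (auto simp: orthogonal_def)
  qed
  then obtain c where c: "c > 0" "\<And>x. x \<in> ?P \<Longrightarrow> norm (?f x) \<ge> c * norm x"
    by blast
  have "c * infdist x ?E \<le> norm (?f x)" for x
  proof -
    obtain y z where yz: "y \<in> span ?E" "\<And>w. w \<in> span ?E \<Longrightarrow> orthogonal z w" "x = y + z"
      using orthogonal_subspace_decomp_exists by blast
    have y: "y \<in> ?E" and z: "z \<in> ?P"
      using yz subspace_eigenspace[of A l] by (auto simp: span_eq_iff[THEN iffD2])
    have "infdist x ?E \<le> norm z"
      using infdist_le[OF y, of x] yz by (simp add: dist_norm)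
    then have "c * infdist x ?E \<le> c * norm z"
      using c(1) by simp
    also have "\<dots> \<le> norm (?f z)"
      using c z by blast
    also have "?f z = ?f x"
      using y yz(3) by (simp add: eigenspace_def matrix_vector_right_distrib algebra_simps)
    finally show ?thesis .
  qed
  with c(1) show thesis by (rule that)
qed

section \<open>Sublinear response functions\<close>

definition componentwise :: "(real \<Rightarrow> real) \<Rightarrow> real^'n \<Rightarrow> real^'n" where
  "componentwise f y = (\<chi> i. f (y $ i))"

lemma componentwise_nth [simp]: "componentwise f y $ i = f (y $ i)"
  by (simp add: componentwise_def)

text \<open>By the mean value theorem \<open>h\<close> falls to its value 0 from the left and rises
  from it to the right. All strict comparisons of functions that agree at the origin go through this
  form.\<close>

lemma DERIV_sgn_imp_pos:
  fixes h h' :: "real \<Rightarrow> real"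
  assumes "h 0 = 0" and deriv: "\<And>z. \<bar>z\<bar> < r \<Longrightarrow> (h has_real_derivative h' z) (at z)"
    and sgn: "\<And>z. z \<noteq> 0 \<Longrightarrow> \<bar>z\<bar> < r \<Longrightarrow> 0 < z * h' z"
    and z: "z \<noteq> 0" "\<bar>z\<bar> < r"
  shows "h z > 0"
proof (cases "z > 0")
  case True
  then obtain y where y: "0 < y" "y < z" "h z - h 0 = (z - 0) * h' y"
    using MVT2[of 0 z h h'] deriv z by force
  with sgn[of y] z True have "h' y > 0" by (simp add: zero_less_mult_iff)
  with y True \<open>h 0 = 0\<close> show ?thesis by simp
next
  case False
  with z obtain y where y: "z < y" "y < 0" "h 0 - h z = (0 - z) * h' y"
    using MVT2[of z 0 h h'] deriv by force
  with sgn[of y] z False have "h' y < 0" by (simp add: zero_less_mult_iff)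
  with y False z have "(0 - z) * h' y < 0" by (simp add: mult_neg_neg)
  with y \<open>h 0 = 0\<close> show ?thesis by simp
qed

text \<open>\<open>S'_less_1\<close> is the integrated form of the sign condition on the second
  derivative: the slope has its strict global maximum 1 at the origin.\<close>

locale sublinear_response =
  fixes S S' :: "real \<Rightarrow> real"
  assumes DERIV_S: "(S has_real_derivative S' z) (at z)"
    and continuous_S': "continuous_on UNIV S'"
    and S_0: "S 0 = 0" and S'_0: "S' 0 = 1"
    and S'_less_1: "z \<noteq> 0 \<Longrightarrow> S' z < 1"
begin

lemma continuous_S: "continuous_on X S"
  using DERIV_S by (meson DERIV_isCont continuous_at_imp_continuous_on)

lemma S'_near_1:
  assumes "e > 0"
  obtains r where "r > 0" "\<And>z. \<bar>z\<bar> < r \<Longrightarrow> \<bar>S' z - 1\<bar> < e"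
proof -
  have "isCont S' 0"
    using continuous_S' by (simp add: continuous_on_eq_continuous_at)
  then obtain r where "r > 0" "\<And>z. dist z 0 < r \<Longrightarrow> dist (S' z) (S' 0) < e"
    using assms unfolding continuous_at_eps_delta by blast
  then show thesis
    by (intro that[of r]) (auto simp: S'_0 dist_real_def)
qed

text \<open>The nonlinear remainder at the origin: since \<open>S' 0 = 1\<close>, it is of smaller
  order than its argument.\<close>

definition defect :: "real^'n \<Rightarrow> real^'n" where
  "defect y = y - componentwise S y"

lemma defect_0 [simp]: "defect 0 = 0"
  by (simp add: defect_def vec_eq_iff S_0)

lemma continuous_on_componentwise_S [continuous_intros]:
  "continuous_on X g \<Longrightarrow> continuous_on X (\<lambda>x. componentwise S (g x))"
  unfolding componentwise_def
  by (intro continuous_intros continuous_on_compose2[OF continuous_S[of UNIV]]) auto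

lemma continuous_on_defect [continuous_intros]:
  "continuous_on X g \<Longrightarrow> continuous_on X (\<lambda>x. defect (g x))"
  unfolding defect_def by (intro continuous_intros)

text \<open>The derivative \<open>1 - S'\<close> of the scalar defect is continuous and vanishes at
  0, so the mean value inequality gives an arbitrarily small Lipschitz constant near 0 in each
  component.\<close>

lemma defect_lipschitz:
  assumes "e > 0"
  obtains r where "r > 0"
    "\<And>y z :: real^'n. norm y \<le> r \<Longrightarrow> norm z \<le> r \<Longrightarrow> norm (defect y - defect z) \<le> e * norm (y - z)"
proof -
  obtain r where r: "r > 0" "\<And>z. \<bar>z\<bar> < r \<Longrightarrow> \<bar>S' z - 1\<bar> < e"
    using S'_near_1[OF assms] by blast
  have real: "\<bar>(a - S a) - (b - S b)\<bar> \<le> e * \<bar>a - b\<bar>" if "\<bar>a\<bar> < r" "\<bar>b\<bar> < r" for a b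
    using field_differentiable_bound[of "ball 0 r" "\<lambda>z. z - S z" "\<lambda>z. 1 - S' z" e a b] that r
    by (force intro!: derivative_eq_intros DERIV_S[THEN DERIV_subset] simp: dist_real_def abs_minus_commute)
  \<comment> \<open>Halving the radius turns the closed balls of the conclusion into the strict
    bounds required by \<open>real\<close>.\<close>
  have "norm (defect y - defect z) \<le> e * norm (y - z)"
    if "norm y \<le> r / 2" "norm z \<le> r / 2" for y z :: "real^'n"
  proof -
    have "norm (defect y - defect z) \<le> norm (e *\<^sub>R (y - z))"
    proof (rule norm_le_componentwise_cart)
      fix i
      have "\<bar>y $ i\<bar> < r" "\<bar>z $ i\<bar> < r"
        using that r(1) component_le_norm_cart[of y i] component_le_norm_cart[of z i] by auto
      then show "norm ((defect y - defect z) $ i) \<le> norm ((e *\<^sub>R (y - z)) $ i)"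
        using real[of "y $ i" "z $ i"] assms by (simp add: defect_def abs_mult)
    qed
    then show ?thesis
      using assms by simp
  qed
  with r(1) show thesis
    by (intro that[of "r / 2"]) auto
qed

lemma defect_small:
  assumes "e > 0"
  obtains r where "r > 0" "\<And>y :: real^'n. norm y \<le> r \<Longrightarrow> norm (defect y) \<le> e * norm y"
proof -
  obtain r where r: "r > 0"
    "\<And>y z :: real^'n. norm y \<le> r \<Longrightarrow> norm z \<le> r \<Longrightarrow> norm (defect y - defect z) \<le> e * norm (y - z)"
    using defect_lipschitz[OF assms] by blast
  from r(2)[of _ 0] r(1) show thesis
    by (intro that[of r]) auto
qed

text \<open>\<open>F z\<close> is the integral of the local inverse of \<open>S\<close> from 0 to
  \<open>S z\<close>. The differences \<open>F z - (S z)\<^sup>2 / 2\<close> and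
  \<open>z\<^sup>2 / 2 - F z\<close> have derivatives \<open>S' z * (z - S z)\<close> and
  \<open>z * (1 - S' z)\<close>, both of the sign of \<open>z\<close>. The lower bound on
  \<open>F\<close> makes the energy positive on small spheres, the upper one makes it negative along
  an eigenvector.\<close>

lemma local_potential:
  obtains F r where "r > 0" "F 0 = 0"
    "\<And>z. \<bar>z\<bar> < r \<Longrightarrow> (F has_real_derivative z * S' z) (at z)"
    "\<And>z. \<bar>z\<bar> < r \<Longrightarrow> S' z > 0"
    "\<And>z. \<bar>z\<bar> < r \<Longrightarrow> \<bar>S z\<bar> \<le> \<bar>z\<bar>"
    "\<And>z. z \<noteq> 0 \<Longrightarrow> \<bar>z\<bar> < r \<Longrightarrow> (S z)\<^sup>2 / 2 < F z"
    "\<And>z. \<bar>z\<bar> < r \<Longrightarrow> F z \<le> z\<^sup>2 / 2"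
proof -
  obtain r0 where r0: "r0 > 0" "\<And>z. \<bar>z\<bar> < r0 \<Longrightarrow> \<bar>S' z - 1\<bar> < 1"
    using S'_near_1[OF zero_less_one] by blast
  \<comment> \<open>Below \<open>r0\<close> the slope is positive; the cap 1 keeps the argument
    inside the interval on which the antiderivative is taken.\<close>
  define r where "r = min r0 1"
  have r: "r > 0" "r \<le> 1"
    using r0 by (auto simp: r_def)
  have pos: "S' z > 0" if "\<bar>z\<bar> < r" for z
    using r0(2)[of z] that by (auto simp: r_def)
  have le1: "S' z \<le> 1" for z
    using S'_less_1[of z] S'_0 by (cases "z = 0") auto
  have "continuous_on {-1..1} (\<lambda>z. z * S' z)"
    by (intro continuous_intros continuous_on_subset[OF continuous_S']) auto
  then obtain F0 where F0: "\<And>z. z \<in> {-1..1} \<Longrightarrow> (F0 has_vector_derivative z * S' z) (at z within {-1..1})"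
    using antiderivative_continuous by blast
  define F where "F z = F0 z - F0 0" for z
  have F: "(F has_real_derivative z * S' z) (at z)" if "\<bar>z\<bar> < r" for z
  proof -
    have "z \<in> interior {-1..1}"
      using that r by auto
    then have "(F0 has_real_derivative z * S' z) (at z)"
      using F0[of z] at_within_interior[of z "{-1..1}"] that r
      by (simp add: has_real_derivative_iff_has_vector_derivative abs_if split: if_splits)
    then show ?thesis
      unfolding F_def by (auto intro!: derivative_eq_intros)
  qed
  have S_less: "0 < z * (z - S z)" if "z \<noteq> 0" for z
  proof (cases "z > 0")
    case True
    then obtain y where "0 < y" "y < z" "(z - S z) - (0 - S 0) = (z - 0) * (1 - S' y)"
      using MVT2[of 0 z "\<lambda>z. z - S z" "\<lambda>z. 1 - S' z"] DERIV_S by (force intro!: derivative_eq_intros)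
    then show ?thesis
      using True S'_less_1[of y] S_0 by simp
  next
    case False
    with that obtain y where "z < y" "y < 0" "(0 - S 0) - (z - S z) = (0 - z) * (1 - S' y)"
      using MVT2[of z 0 "\<lambda>z. z - S z" "\<lambda>z. 1 - S' z"] DERIV_S by (force intro!: derivative_eq_intros)
    then have "z - S z = z * (1 - S' y)"
      using S_0 by simp
    then have "z * (z - S z) = z * z * (1 - S' y)" by simp
    then show ?thesis
      using S'_less_1[of y] \<open>y < 0\<close> that by (metis diff_gt_0_iff_gt less_irrefl mult_pos_pos mult_neg_neg linorder_neqE_linordered_idom)
  qed
  show thesis
  proof (rule that[of r F])
    show "\<bar>S z\<bar> \<le> \<bar>z\<bar>" if "\<bar>z\<bar> < r" for z
    proof -
      have "norm (S z - S 0) \<le> 1 * norm (z - 0)"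
      proof (rule field_differentiable_bound[of "ball 0 r"])
        show "norm (S' a) \<le> 1" if "a \<in> ball 0 r" for a
          using pos[of a] le1[of a] that by simp
      qed (use that r DERIV_S in \<open>auto intro: has_field_derivative_at_within\<close>)
      then show ?thesis
        using S_0 by simp
    qed
    show "(S z)\<^sup>2 / 2 < F z" if "z \<noteq> 0" "\<bar>z\<bar> < r" for z
    proof -
      have "0 < F z - (S z)\<^sup>2 / 2"
      proof (rule DERIV_sgn_imp_pos[where h = "\<lambda>z. F z - (S z)\<^sup>2 / 2" and h' = "\<lambda>z. S' z * (z - S z)", OF _ _ _ that])
        show "F 0 - (S 0)\<^sup>2 / 2 = 0"
          by (simp add: F_def S_0)
        show "((\<lambda>z. F z - (S z)\<^sup>2 / 2) has_real_derivative S' z * (z - S z)) (at z)" if "\<bar>z\<bar> < r" for z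
          by (auto intro!: derivative_eq_intros F[OF that] DERIV_S simp: field_simps)
        show "0 < z * (S' z * (z - S z))" if "z \<noteq> 0" "\<bar>z\<bar> < r" for z
          using mult_pos_pos[OF pos[OF that(2)] S_less[OF that(1)]] by (simp add: mult_ac)
      qed
      then show ?thesis by simp
    qed
    show "F z \<le> z\<^sup>2 / 2" if "\<bar>z\<bar> < r" for z
    proof (cases "z = 0")
      case False
      have "0 < z\<^sup>2 / 2 - F z"
      proof (rule DERIV_sgn_imp_pos[where h = "\<lambda>z. z\<^sup>2 / 2 - F z" and h' = "\<lambda>z. z * (1 - S' z)", OF _ _ _ False that])
        show "0\<^sup>2 / 2 - F 0 = 0"
          by (simp add: F_def)
        show "((\<lambda>z. z\<^sup>2 / 2 - F z) has_real_derivative z * (1 - S' z)) (at z)" if "\<bar>z\<bar> < r" for z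
          by (auto intro!: derivative_eq_intros F[OF that] simp: field_simps)
        show "0 < z * (z * (1 - S' z))" if "z \<noteq> 0" for z
          using S'_less_1[OF that] that by (auto simp: zero_less_mult_iff mult_less_0_iff linorder_neq_iff)
      qed
      then show ?thesis by simp
    qed (simp add: F_def)
  qed (use r pos F in \<open>auto simp: F_def\<close>)
qed

end

section \<open>Bifurcation of equilibria\<close>

text \<open>\<open>mu_eigenvalue\<close> and \<open>Rayleigh\<close> together make \<mu> the largest
  eigenvalue of \<open>B\<close>; in this form both signs of the coupling are a single case.\<close>

locale critical_network = sublinear_response +
  fixes B :: "real^'n^'n" and \<mu> d :: real
  assumes symmetric: "symmetric_matrix B"
    and mu_pos: "\<mu> > 0" and d_pos: "d > 0"
    and mu_eigenvalue: "\<mu> \<in> eigenvalues B"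
    and Rayleigh: "x \<bullet> (B *v x) \<le> \<mu> * (x \<bullet> x)"
begin

section \<open>Small equilibria by energy minimisation\<close>

definition vector_field :: "real \<Rightarrow> real^'n \<Rightarrow> real^'n" where
  "vector_field u x = u *\<^sub>R componentwise S (B *v x) - d *\<^sub>R x"

text \<open>
  The gradient of \<open>\<Psi> y = (\<Sum>i. F (y\<^sub>i)) - k/2 \<sigma> \<bullet> B \<sigma>\<close>, where \<open>\<sigma> = componentwise S y\<close> and \<open>F' z = z S' z\<close>, is
  \<open>S' (y\<^sub>i) (y - k B \<sigma>)\<^sub>i\<close>; its zeros \<open>y = k B \<sigma>\<close> yield equilibria \<open>x = k \<sigma>\<close> for \<open>u = k d\<close>, without inverting
  \<open>B\<close> or \<open>S\<close>.
\<close>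

lemma energy_critical_point:
  fixes y :: "real^'n"
  defines "\<Psi> \<equiv> \<lambda>F k (y::real^'n). (\<Sum>i\<in>UNIV. F (y $ i)) - k / 2 * (componentwise S y \<bullet> (B *v componentwise S y))"
  assumes F: "\<And>i. (F has_real_derivative y $ i * S' (y $ i)) (at (y $ i))"
    and S': "\<And>i. S' (y $ i) > 0"
    and "e > 0" and min: "\<And>z. dist y z < e \<Longrightarrow> \<Psi> F k y \<le> \<Psi> F k z"
  shows "y = k *\<^sub>R (B *v componentwise S y)"
proof -
  have "y $ i = k * (B *v componentwise S y) $ i" for i
  proof -
    define q where "q t = S (y $ i + t) - S (y $ i)" for t
    \<comment> \<open>The energy along the \<open>i\<close>-th coordinate line through
      \<open>y\<close>: only the \<open>i\<close>-th entry of \<open>componentwise S y\<close>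
      moves, by \<open>q t\<close>. As \<open>q 0 = 0\<close>, the quadratic term has zero
      derivative at 0, and positivity of \<open>S'\<close> lets it be cancelled from the
      critical-point equation.\<close>
    define \<phi> where "\<phi> t = \<Psi> F k y - F (y $ i) + F (y $ i + t)
      - k / 2 * (2 * q t * (B *v componentwise S y) $ i + (q t)\<^sup>2 * B $ i $ i)" for t
    have shift: "\<Psi> F k (y + t *\<^sub>R axis i 1) = \<phi> t" for t
    proof -
      have cw: "componentwise S (y + t *\<^sub>R axis i 1) = componentwise S y + q t *\<^sub>R axis i 1"
        by (auto simp: vec_eq_iff q_def axis_def)
      have sum: "(\<Sum>j\<in>UNIV. F ((y + t *\<^sub>R axis i 1) $ j)) = (\<Sum>j\<in>UNIV. F (y $ j)) - F (y $ i) + F (y $ i + t)"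
        by (simp add: sum.remove[of UNIV i] axis_def)
      have Bii: "(B *v axis i 1) $ i = B $ i $ i"
        by (simp add: matrix_vector_mult_basis column_def)
      have "componentwise S y \<bullet> (B *v axis i 1) = (B *v componentwise S y) $ i"
        using symmetric_matrix_inner[OF symmetric, of "componentwise S y" "axis i 1"]
        by (simp add: inner_axis)
      then show ?thesis
        unfolding \<phi>_def \<Psi>_def cw sum
        by (simp add: matrix_vector_right_distrib matrix_vector_mult_scaleR inner_add_left
            inner_add_right inner_axis' Bii power2_eq_square algebra_simps)
    qed
    have DS: "((\<lambda>t. S (y $ i + t)) has_real_derivative S' (y $ i)) (at 0)"
      and DF: "((\<lambda>t. F (y $ i + t)) has_real_derivative y $ i * S' (y $ i)) (at 0)"
      using DERIV_S[of "y $ i"] F[of i] DERIV_shift[of _ _ 0 "y $ i"] by (simp_all add: add.commute)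
    have "(\<phi> has_real_derivative S' (y $ i) * (y $ i - k * (B *v componentwise S y) $ i)) (at 0)"
      unfolding \<phi>_def q_def
      by (rule derivative_eq_intros DS DF refl)+ (simp add: field_simps)
    moreover have "\<phi> 0 \<le> \<phi> t" if "\<bar>0 - t\<bar> < e" for t
      using min[of "y + t *\<^sub>R axis i 1"] that shift[of 0] shift[of t]
      by (simp add: dist_norm norm_axis_1)
    ultimately have "S' (y $ i) * (y $ i - k * (B *v componentwise S y) $ i) = 0"
      using DERIV_local_min[OF _ \<open>e > 0\<close>] by blast
    with S'[of i] show ?thesis by simp
  qed
  then show ?thesis
    by (simp add: vec_eq_iff)
qed

text \<open>On a small sphere the energy stays positive for \<open>k = u / d\<close> slightly above
  \<open>1 / \<mu>\<close>, while it is negative somewhere in the ball and 0 at the origin. A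
  minimiser over the ball is thus interior and nonzero, and \<open>energy_critical_point\<close>
  applies to it.\<close>

lemma small_equilibrium_exists:
  assumes "r > 0"
  obtains \<delta> where "\<delta> > 0"
    "\<And>u. d / \<mu> < u \<Longrightarrow> u < d / \<mu> + \<delta> \<Longrightarrow> \<exists>x. x \<noteq> 0 \<and> vector_field u x = 0 \<and> norm x < r"
proof -
  obtain F r0 where r0: "r0 > 0" and F0: "F 0 = 0"
    and DF: "\<And>z. \<bar>z\<bar> < r0 \<Longrightarrow> (F has_real_derivative z * S' z) (at z)"
    and S'_pos: "\<And>z. \<bar>z\<bar> < r0 \<Longrightarrow> S' z > 0"
    and S_le: "\<And>z. \<bar>z\<bar> < r0 \<Longrightarrow> \<bar>S z\<bar> \<le> \<bar>z\<bar>"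
    and F_gt: "\<And>z. z \<noteq> 0 \<Longrightarrow> \<bar>z\<bar> < r0 \<Longrightarrow> (S z)\<^sup>2 / 2 < F z"
    and F_le: "\<And>z. \<bar>z\<bar> < r0 \<Longrightarrow> F z \<le> z\<^sup>2 / 2"
    by (rule local_potential[of thesis]) (rule that)
  \<comment> \<open>The first bound keeps the closed ball inside the domain of the potential; the
    second makes the equilibrium, of norm at most \<open>k * \<rho>\<close> with
    \<open>k < 2 / \<mu>\<close>, smaller than \<open>r\<close>.\<close>
  define \<rho> where "\<rho> = min (r0 / 2) (r * \<mu> / 4)"
  have \<rho>: "\<rho> > 0" "\<rho> < r0" "\<rho> \<le> r * \<mu> / 4"
    using r0 assms mu_pos by (auto simp: \<rho>_def)
  have comp: "\<bar>y $ i\<bar> < r0" if "norm y \<le> \<rho>" for y :: "real^'n" and i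
    using that \<rho> component_le_norm_cart[of y i] by linarith
  have norm_S_le: "norm (componentwise S y) \<le> norm y" if "norm y \<le> \<rho>" for y :: "real^'n"
    by (rule norm_le_componentwise_cart) (use S_le comp[OF that] in auto)
  have contF: "continuous_on (cball 0 \<rho>) (\<lambda>y::real^'n. F (y $ i))" for i
  proof (rule continuous_on_compose2[where g = F and f = "\<lambda>y. y $ i" and t = "{-r0<..<r0}"])
    show "continuous_on {-r0<..<r0} F"
      by (intro continuous_at_imp_continuous_on ballI DERIV_isCont[OF DF]) auto
    show "(\<lambda>y. y $ i) ` cball 0 \<rho> \<subseteq> {-r0<..<r0}"
    proof
      fix a assume "a \<in> (\<lambda>y::real^'n. y $ i) ` cball 0 \<rho>"
      then have "\<bar>a\<bar> < r0" using comp by auto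
      then show "a \<in> {-r0<..<r0}" by auto
    qed
  qed (intro continuous_intros)
  \<comment> \<open>By the Rayleigh bound \<open>H\<close> minorises the energy at the critical
    value \<open>k = 1 / \<mu>\<close>. It does not depend on \<open>k\<close>, so its minimum
    \<open>m\<close> over the sphere is a barrier for all nearby parameters.\<close>
  define H where "H y = (\<Sum>i\<in>UNIV. F (y $ i) - (S (y $ i))\<^sup>2 / 2)" for y :: "real^'n"
  have contH: "continuous_on (cball 0 \<rho>) H"
    unfolding H_def
    by (intro continuous_intros contF continuous_on_compose2[OF continuous_S[of UNIV]]) auto
  obtain z :: "real^'n" where z: "norm z = \<rho>" and z_min: "\<And>y. norm y = \<rho> \<Longrightarrow> H z \<le> H y"
  proof -
    have "\<exists>z\<in>sphere 0 \<rho>. \<forall>y\<in>sphere 0 \<rho>. H z \<le> H y"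
      using \<rho> by (intro continuous_attains_inf continuous_on_subset[OF contH]) auto
    with that show thesis by auto
  qed
  define m where "m = H z"
  have m: "m > 0"
  proof -
    have "z \<noteq> 0" using z \<rho> by auto
    then obtain i where "z $ i \<noteq> 0"
      by (auto simp: vec_eq_iff)
    then have "0 < F (z $ i) - (S (z $ i))\<^sup>2 / 2"
      using F_gt comp[of z i] z by simp
    moreover have "0 \<le> F (z $ j) - (S (z $ j))\<^sup>2 / 2" for j
      using F_gt[of "z $ j"] comp[of z j] z F0 S_0 by (cases "z $ j = 0") auto
    ultimately show ?thesis
      unfolding m_def H_def by (intro sum_pos2[of _ i]) auto
  qed
  \<comment> \<open>The first entry yields \<open>k < 2 / \<mu>\<close>, the second
    \<open>(k * \<mu> - 1) * \<rho>\<^sup>2 < m\<close>, which preserves the barrier.\<close>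
  define \<delta> where "\<delta> = min (d / \<mu>) (m * d / (\<mu> * \<rho>\<^sup>2))"
  have "\<delta> > 0"
    using m d_pos mu_pos \<rho> by (auto simp: \<delta>_def)
  have "\<exists>x. x \<noteq> 0 \<and> vector_field u x = 0 \<and> norm x < r" if u: "d / \<mu> < u" "u < d / \<mu> + \<delta>" for u
  proof -
    define k where "k = u / d"
    have k: "k > 0" "k * \<mu> > 1" "k < 2 / \<mu>"
    proof -
      have "u < 2 * (d / \<mu>)" using u by (simp add: \<delta>_def)
      with u d_pos mu_pos show "k * \<mu> > 1" "k < 2 / \<mu>"
        by (simp_all add: k_def field_simps)
      then show "k > 0"
        using mu_pos by (metis less_trans zero_less_mult_pos2 zero_less_one)
    qed
    have k_m: "(k * \<mu> - 1) * \<rho>\<^sup>2 < m"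
    proof -
      have "u - d / \<mu> < m * d / (\<mu> * \<rho>\<^sup>2)"
        using u by (simp add: \<delta>_def)
      then have "(u - d / \<mu>) * (\<mu> / d * \<rho>\<^sup>2) < m * d / (\<mu> * \<rho>\<^sup>2) * (\<mu> / d * \<rho>\<^sup>2)"
        using d_pos mu_pos \<rho> by (intro mult_strict_right_mono) auto
      also have "\<dots> = m"
        using d_pos mu_pos \<rho> by simp
      also have "(u - d / \<mu>) * (\<mu> / d * \<rho>\<^sup>2) = (k * \<mu> - 1) * \<rho>\<^sup>2"
        using d_pos mu_pos by (simp add: k_def field_simps)
      finally show ?thesis .
    qed
    define \<Psi> where "\<Psi> y = (\<Sum>i\<in>UNIV. F (y $ i)) - k / 2 * (componentwise S y \<bullet> (B *v componentwise S y))"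
      for y :: "real^'n"
    have "continuous_on (cball 0 \<rho>) \<Psi>"
      unfolding \<Psi>_def by (intro continuous_intros contF bounded_linear.continuous_on[OF matrix_vector_mul_bounded_linear])
    then obtain y where y: "norm y \<le> \<rho>" and y_min: "\<And>w. norm w \<le> \<rho> \<Longrightarrow> \<Psi> y \<le> \<Psi> w"
      using continuous_attains_inf[of "cball 0 \<rho>" \<Psi>] \<rho> by force
    have sphere: "\<Psi> w > 0" if w: "norm w = \<rho>" for w
    proof -
      let ?q = "componentwise S w \<bullet> componentwise S w"
      have "?q \<le> \<rho>\<^sup>2"
        using power_mono[OF norm_S_le[of w], of 2] w by (simp add: dot_square_norm)
      then have "(k * \<mu> - 1) * ?q \<le> (k * \<mu> - 1) * \<rho>\<^sup>2"
        using k by (intro mult_left_mono) auto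
      with k_m have "(k * \<mu> - 1) * ?q < m" by linarith
      moreover have "k * (componentwise S w \<bullet> (B *v componentwise S w)) \<le> k * (\<mu> * ?q)"
        using k Rayleigh by simp
      moreover have "H w = (\<Sum>i\<in>UNIV. F (w $ i)) - ?q / 2"
        by (simp add: H_def sum_subtractf inner_vec_def power2_eq_square sum_divide_distrib)
      moreover have "m \<le> H w"
        using z_min[OF w] by (simp add: m_def)
      ultimately show ?thesis
        using m by (simp add: \<Psi>_def algebra_simps)
    qed
    obtain w where w: "norm w \<le> \<rho>" "\<Psi> w < 0"
    proof -
      obtain v where v: "v \<noteq> 0" "B *v v = \<mu> *\<^sub>R v"
        using mu_eigenvalue by (auto simp: eigenvalues_def)
      \<comment> \<open>Rescaled so that it tends to \<open>v\<close> as \<open>t\<close> tends to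
        0. Then the energy at \<open>t *\<^sub>R v\<close>, divided by \<open>t\<^sup>2\<close>, is
        at most a quantity with limit \<open>(1 - k * \<mu>) * (v \<bullet> v) / 2\<close>, which is
        negative.\<close>
      define \<sigma> where "\<sigma> t = (1 / t) *\<^sub>R componentwise S (t *\<^sub>R v)" for t
      have "((\<lambda>t. (1 / t) *\<^sub>R componentwise S (t *\<^sub>R v)) \<longlongrightarrow> v) (at_right 0)"
      proof (rule vec_tendstoI)
        fix i
        have "((\<lambda>t. S (t * v $ i)) has_real_derivative v $ i) (at 0)"
        proof -
          have "((\<lambda>t. t * v $ i) has_real_derivative v $ i) (at 0)"
            by (auto intro!: derivative_eq_intros)
          moreover have "(S has_real_derivative 1) (at (0 * v $ i))"
            using DERIV_S[of 0] S'_0 by simp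
          ultimately have "((\<lambda>t. S (t * v $ i)) has_real_derivative 1 * v $ i) (at 0)"
            by (intro DERIV_chain2[where g = "\<lambda>t. t * v $ i"])
          then show ?thesis by simp
        qed
        then have "((\<lambda>t. S (t * v $ i) / t) \<longlongrightarrow> v $ i) (at 0)"
          by (simp add: DERIV_def S_0)
        then show "((\<lambda>t. ((1 / t) *\<^sub>R componentwise S (t *\<^sub>R v)) $ i) \<longlongrightarrow> v $ i) (at_right 0)"
          by (simp add: filterlim_at_split)
      qed
      then have "((\<lambda>t. (v \<bullet> v) / 2 - k / 2 * (\<sigma> t \<bullet> (B *v \<sigma> t))) \<longlongrightarrow> (v \<bullet> v) / 2 - k / 2 * (v \<bullet> (B *v v))) (at_right 0)"
        unfolding \<sigma>_def by (intro tendsto_intros bounded_linear.tendsto[OF matrix_vector_mul_bounded_linear])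
      moreover have "(v \<bullet> v) / 2 - k / 2 * (v \<bullet> (B *v v)) < 0"
        using v k by (simp add: mult.assoc[symmetric])
      ultimately have "\<forall>\<^sub>F t in at_right 0. (v \<bullet> v) / 2 - k / 2 * (\<sigma> t \<bullet> (B *v \<sigma> t)) < 0"
        by (rule order_tendstoD)
      moreover have "\<forall>\<^sub>F t in at_right 0. t \<in> {0<..<\<rho> / norm v}"
        by (rule eventually_at_right_real) (use \<rho> v in simp)
      ultimately have "\<forall>\<^sub>F t in at_right 0. norm (t *\<^sub>R v) \<le> \<rho> \<and> \<Psi> (t *\<^sub>R v) < 0"
      proof eventually_elim
        case (elim t)
        then have t: "t > 0" and nt: "norm (t *\<^sub>R v) \<le> \<rho>"
          using v by (auto simp: field_simps)
        have \<sigma>: "componentwise S (t *\<^sub>R v) = t *\<^sub>R \<sigma> t"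
          using t by (simp add: \<sigma>_def)
        have "(\<Sum>i\<in>UNIV. F ((t *\<^sub>R v) $ i)) \<le> (\<Sum>i\<in>UNIV. ((t *\<^sub>R v) $ i)\<^sup>2 / 2)"
          using F_le comp[OF nt] by (intro sum_mono) blast
        also have "\<dots> = t\<^sup>2 * ((v \<bullet> v) / 2)"
          by (simp add: inner_vec_def power2_eq_square sum_divide_distrib sum_distrib_left mult_ac)
        finally have "\<Psi> (t *\<^sub>R v) \<le> t\<^sup>2 * ((v \<bullet> v) / 2 - k / 2 * (\<sigma> t \<bullet> (B *v \<sigma> t)))"
          unfolding \<Psi>_def \<sigma> by (simp add: matrix_vector_mult_scaleR power2_eq_square algebra_simps)
        also have "\<dots> < 0"
          using elim t by (intro mult_pos_neg) auto
        finally show ?case using nt by blast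
      qed
      then show thesis
        using that eventually_happens'[OF trivial_limit_at_right_real] by blast
    qed
    have y_neg: "\<Psi> y < 0"
      using y_min[OF w(1)] w(2) by simp
    have "y \<noteq> 0"
      using y_neg by (auto simp: \<Psi>_def F0 S_0 inner_vec_def)
    have "norm y < \<rho>"
      using sphere[of y] y y_neg by fastforce
    have "y = k *\<^sub>R (B *v componentwise S y)"
    proof (rule energy_critical_point)
      show "0 < \<rho> - norm y" using \<open>norm y < \<rho>\<close> by simp
      show "(\<Sum>i\<in>UNIV. F (y $ i)) - k / 2 * (componentwise S y \<bullet> (B *v componentwise S y))
        \<le> (\<Sum>i\<in>UNIV. F (w $ i)) - k / 2 * (componentwise S w \<bullet> (B *v componentwise S w))"
        if "dist y w < \<rho> - norm y" for w
        using y_min[of w] that norm_triangle_ineq2[of w y] by (simp add: \<Psi>_def dist_norm norm_minus_commute)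
    qed (use DF S'_pos comp[OF y] in auto)
    then have By: "B *v (k *\<^sub>R componentwise S y) = y"
      by (simp add: matrix_vector_mult_scaleR)
    show ?thesis
    proof (intro exI conjI)
      show "k *\<^sub>R componentwise S y \<noteq> 0"
        using By \<open>y \<noteq> 0\<close> by fastforce
      show "vector_field u (k *\<^sub>R componentwise S y) = 0"
        unfolding vector_field_def By using d_pos by (simp add: k_def)
      have "norm (k *\<^sub>R componentwise S y) \<le> k * \<rho>"
        using k norm_S_le[OF y] y by simp
      also have "\<dots> < 2 / \<mu> * \<rho>"
        using k \<rho> by (intro mult_strict_right_mono)
      also have "\<dots> \<le> 2 / \<mu> * (r * \<mu> / 4)"
        using \<rho> mu_pos by (intro mult_left_mono) auto
      also have "\<dots> \<le> r"
        using mu_pos assms by simp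
      finally show "norm (k *\<^sub>R componentwise S y) < r" .
    qed
  qed
  with \<open>\<delta> > 0\<close> show thesis by (rule that)
qed

section \<open>Tangency and the branch over supercritical parameters\<close>

text \<open>With \<open>y = B *v x\<close> and \<open>k = u / d\<close>, the residual
  \<open>y - \<mu> *\<^sub>R x\<close> equals
  \<open>(1 - \<mu> * k) *\<^sub>R y + (\<mu> * k) *\<^sub>R defect y\<close>. Both terms are of
  smaller order than \<open>x\<close>, and \<open>infdist_eigenspace_le\<close> turns this into
  tangency.\<close>

lemma equilibria_tangent:
  assumes eq: "\<forall>\<^sub>F s in at_right 0. x s \<noteq> 0 \<and> vector_field (u s) (x s) = 0"
    and x: "(x \<longlongrightarrow> 0) (at_right 0)" and u: "(u \<longlongrightarrow> d / \<mu>) (at_right 0)"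
  shows "((\<lambda>s. infdist (x s) (eigenspace B \<mu>) / norm (x s)) \<longlongrightarrow> 0) (at_right 0)"
proof (rule tendstoI)
  fix e :: real assume "e > 0"
  obtain c where c: "c > 0" "\<And>x. c * infdist x (eigenspace B \<mu>) \<le> norm (B *v x - \<mu> *\<^sub>R x)"
    using infdist_eigenspace_le by blast
  obtain b where b: "b > 0" "\<And>x. norm (B *v x) \<le> norm x * b"
    using bounded_linear.pos_bounded[OF matrix_vector_mul_bounded_linear] by blast
  \<comment> \<open>The residual will be at most \<open>3 * \<eta> * b\<close> times the norm of
    \<open>x s\<close>; the factor 6 leaves strict room below \<open>e * c\<close>, and the cap 1
    gives \<open>\<bar>\<mu> * k\<bar> \<le> 2\<close>.\<close>
  define \<eta> where "\<eta> = min 1 (e * c / (6 * b))"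
  have \<eta>: "\<eta> > 0" "\<eta> \<le> 1" "3 * \<eta> * b < e * c"
    using \<open>e > 0\<close> b c by (auto simp: \<eta>_def min_def field_simps)
  obtain r where r: "r > 0" "\<And>y :: real^'n. norm y \<le> r \<Longrightarrow> norm (defect y) \<le> \<eta> * norm y"
    using defect_small[OF \<eta>(1)] by blast
  have "((\<lambda>s. 1 - \<mu> * (u s / d)) \<longlongrightarrow> 1 - \<mu> * (d / \<mu> / d)) (at_right 0)"
    by (intro tendsto_intros u) (use d_pos in simp)
  then have "\<forall>\<^sub>F s in at_right 0. dist (1 - \<mu> * (u s / d)) 0 < \<eta>"
    using \<eta> mu_pos d_pos by (intro tendstoD) simp_all
  moreover have "((\<lambda>s. B *v x s) \<longlongrightarrow> B *v 0) (at_right 0)"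
    by (intro bounded_linear.tendsto[OF matrix_vector_mul_bounded_linear] x)
  then have "\<forall>\<^sub>F s in at_right 0. dist (B *v x s) 0 < r"
    using r by (intro tendstoD) simp_all
  ultimately show "\<forall>\<^sub>F s in at_right 0. dist (infdist (x s) (eigenspace B \<mu>) / norm (x s)) 0 < e"
    using eq
  proof eventually_elim
    case (elim s)
    define y where "y = B *v x s"
    define k where "k = u s / d"
    have k: "\<bar>1 - \<mu> * k\<bar> < \<eta>" and k2: "\<bar>\<mu> * k\<bar> \<le> 2" and y: "norm y \<le> r"
      using elim \<eta> by (auto simp: k_def y_def)
    have "x s = k *\<^sub>R componentwise S y"
    proof -
      have "d *\<^sub>R x s = u s *\<^sub>R componentwise S y"
        using elim by (simp add: vector_field_def y_def)
      then have "(1 / d) *\<^sub>R (d *\<^sub>R x s) = (1 / d) *\<^sub>R (u s *\<^sub>R componentwise S y)" by simp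
      then show ?thesis using d_pos by (simp add: k_def)
    qed
    then have "y - \<mu> *\<^sub>R x s = (1 - \<mu> * k) *\<^sub>R y + (\<mu> * k) *\<^sub>R defect y"
      by (simp add: defect_def algebra_simps)
    also have "norm \<dots> \<le> \<bar>1 - \<mu> * k\<bar> * norm y + \<bar>\<mu> * k\<bar> * norm (defect y)"
      by (rule order_trans[OF norm_triangle_ineq]) simp
    also have "\<dots> \<le> \<eta> * norm y + 2 * (\<eta> * norm y)"
      using k k2 r(2)[OF y] by (intro add_mono mult_mono) auto
    also have "\<dots> = 3 * \<eta> * norm y" by simp
    also have "\<dots> \<le> 3 * \<eta> * (norm (x s) * b)"
      using b(2)[of "x s"] \<eta> by (intro mult_left_mono) (auto simp: y_def)
    finally have "c * infdist (x s) (eigenspace B \<mu>) \<le> (3 * \<eta> * b) * norm (x s)"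
      using c(2)[of "x s"] by (simp add: y_def mult_ac)
    also have "\<dots> < (e * c) * norm (x s)"
      using \<eta> elim by simp
    finally have "infdist (x s) (eigenspace B \<mu>) < e * norm (x s)"
      using c(1) by (simp add: mult_ac)
    then show ?case
      using elim by (simp add: infdist_nonneg field_simps)
  qed
qed

lemma equilibrium_branchI:
  assumes eq: "\<forall>\<^sub>F s in at_right 0. x s \<noteq> 0 \<and> vector_field (u s) (x s) = 0"
    and x: "(x \<longlongrightarrow> 0) (at_right 0)" and u: "(u \<longlongrightarrow> d / \<mu>) (at_right 0)"
  shows "equilibrium_branch vector_field (d / \<mu>) (eigenspace B \<mu>) x u"
proof -
  have "\<forall>\<^sub>F s in at_right 0. u s > 0"
    using u d_pos mu_pos by (intro order_tendstoD(1)[OF u]) simp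
  with eq have "\<forall>\<^sub>F s in at_right 0. (x s, u s) \<in> nonzero_equilibria vector_field"
    by eventually_elim (simp add: nonzero_equilibria_def)
  then show ?thesis
    using equilibria_tangent[OF assms] x u by (simp add: equilibrium_branch_def)
qed

lemma branch_over_supercritical_parameters:
  "\<exists>x. equilibrium_branch vector_field (d / \<mu>) (eigenspace B \<mu>) x (\<lambda>s. d / \<mu> + s)"
proof -
  have "\<forall>\<^sub>F s in at_right 0. \<exists>x. (x \<noteq> 0 \<and> vector_field (d / \<mu> + s) x = 0) \<and> norm x < r" if r: "r > 0" for r
  proof -
    obtain \<delta> where \<delta>: "\<delta> > 0"
      "\<And>u. d / \<mu> < u \<Longrightarrow> u < d / \<mu> + \<delta> \<Longrightarrow> \<exists>x. x \<noteq> 0 \<and> vector_field u x = 0 \<and> norm x < r"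
      using small_equilibrium_exists[OF r] by blast
    show ?thesis
      using eventually_at_right_real[OF \<delta>(1)]
    proof eventually_elim
      case (elim s)
      then show ?case using \<delta>(2)[of "d / \<mu> + s"] by auto
    qed
  qed
  then obtain x where "\<forall>\<^sub>F s in at_right 0. x s \<noteq> 0 \<and> vector_field (d / \<mu> + s) (x s) = 0"
    "(x \<longlongrightarrow> 0) (at_right 0)"
    by (rule selection_tendsto_0[of "\<lambda>s x. x \<noteq> 0 \<and> vector_field (d / \<mu> + s) x = 0"]) blast
  moreover have "((\<lambda>s. d / \<mu> + s) \<longlongrightarrow> d / \<mu>) (at_right 0)"
    by (rule tendsto_eq_intros | simp)+
  ultimately show ?thesis
    using equilibrium_branchI by blast
qed

section \<open>Continuous branch at a simple eigenvalue\<close>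

text \<open>Adding the projection onto the simple kernel makes \<open>\<mu> - B\<close> invertible:
  pairing a null vector with \<open>v\<close> shows, by symmetry, that it is orthogonal to
  \<open>v\<close>; it then lies in the kernel, the span of \<open>v\<close>, and vanishes.\<close>

lemma bordered_operator_inverse:
  assumes dim: "dim (eigenspace B \<mu>) = 1"
  obtains v :: "real^'n" and L where "norm v = 1" "B *v v = \<mu> *\<^sub>R v" "bounded_linear L"
    "\<And>y. \<mu> *\<^sub>R L y - B *v L y + (v \<bullet> L y) *\<^sub>R v = y"
proof -
  obtain v0 where v0: "v0 \<noteq> 0" "B *v v0 = \<mu> *\<^sub>R v0"
    using mu_eigenvalue by (auto simp: eigenvalues_def)
  define v where "v = v0 /\<^sub>R norm v0"
  have v: "norm v = 1" "B *v v = \<mu> *\<^sub>R v"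
    using v0 by (simp_all add: v_def matrix_vector_mult_scaleR)
  have "v \<noteq> 0" using v by auto
  then have E: "span {v} = eigenspace B \<mu>"
    using v dim by (intro subspace_dim_equal subspace_span subspace_eigenspace span_minimal)
      (auto simp: eigenspace_def)
  let ?M = "\<lambda>x. \<mu> *\<^sub>R x - B *v x + (v \<bullet> x) *\<^sub>R v"
  have lin: "linear ?M"
    by (rule linearI) (simp_all add: matrix_vector_right_distrib matrix_vector_mult_scaleR
        inner_add_right algebra_simps)
  have "x = 0" if "?M x = 0" for x
  proof -
    have "v \<bullet> ?M x = v \<bullet> x"
      using symmetric_matrix_inner[OF symmetric, of v x] v
      by (simp add: inner_add_right inner_diff_right norm_eq_1)
    then have vx: "v \<bullet> x = 0"
      using that by simp
    then have "x \<in> span {v}"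
      using that by (simp add: E eigenspace_def)
    with vx v show "x = 0"
      by (auto simp: span_singleton norm_eq_1)
  qed
  then have "inj ?M"
    using linear_injective_0[OF lin] by blast
  then obtain L where "linear L" "?M \<circ> L = id"
    using linear_surjective_right_inverse[OF lin linear_injective_imp_surjective[OF lin]] by blast
  then show thesis
    by (intro that[OF v]) (auto simp: linear_conv_bounded_linear dest: fun_cong)
qed

text \<open>
  Lyapunov--Schmidt reduction in the blown-up coordinates \<open>x = s (v + w)\<close> with \<open>w\<close> orthogonal to \<open>v\<close>.  Put
  \<open>n = defect (s B (v + w)) / s\<close>.  With the multiplier \<open>d / u = \<mu> - v \<bullet> n\<close> the equilibrium equation reads
  \<open>(\<mu> - B) w = (v \<bullet> n) w - n + (v \<bullet> n) v\<close>, whose solution operator is a contraction on the unit ball,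
  uniformly in small \<open>s\<close>, because the Lipschitz constant of the defect tends to \<open>0\<close> at the origin.
\<close>

lemma continuous_branch:
  assumes dim: "dim (eigenspace B \<mu>) = 1"
  shows "\<exists>x u. equilibrium_branch vector_field (d / \<mu>) (eigenspace B \<mu>) x u \<and>
    (\<forall>\<^sub>F s in at_right 0. isCont x s \<and> isCont u s)"
proof -
  obtain v :: "real^'n" and L where v: "norm v = 1" "B *v v = \<mu> *\<^sub>R v" and L: "bounded_linear L"
    and L_inv: "\<And>y. \<mu> *\<^sub>R L y - B *v L y + (v \<bullet> L y) *\<^sub>R v = y"
    using bordered_operator_inverse[OF dim] by blast
  obtain b where b: "b > 0" "\<And>x. norm (B *v x) \<le> norm x * b"
    using bounded_linear.pos_bounded[OF matrix_vector_mul_bounded_linear] by blast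
  obtain l where l: "l > 0" "\<And>x. norm (L x) \<le> norm x * l"
    using bounded_linear.pos_bounded[OF L] by blast
  define n where "n s w = (1 / s) *\<^sub>R defect (s *\<^sub>R (B *v (v + w)))" for s w
  define T where "T s w = L ((v \<bullet> n s w) *\<^sub>R w - n s w + (v \<bullet> n s w) *\<^sub>R v)" for s w
  have vn: "\<bar>v \<bullet> y\<bar> \<le> norm y" for y
    using Cauchy_Schwarz_ineq2[of v y] v by simp
  have arg: "norm (B *v (v + w)) \<le> 2 * b" if "norm w \<le> 1" for w
  proof -
    have "norm (v + w) \<le> 2"
      using norm_triangle_ineq[of v w] v that by simp
    then have "norm (v + w) * b \<le> 2 * b"
      using b by simp
    then show ?thesis
      using b(2)[of "v + w"] by linarith
  qed
  \<comment> \<open>The factor \<open>1 / s\<close> in \<open>n\<close> cancels the \<open>s\<close>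
    in the argument of the defect, so the bounds are uniform in small \<open>s\<close>.\<close>
  have n_small: "\<exists>s0>0. \<forall>s w z. 0 < s \<longrightarrow> s < s0 \<longrightarrow> norm w \<le> 1 \<longrightarrow> norm z \<le> 1 \<longrightarrow>
      norm (n s w - n s z) \<le> e * b * norm (w - z) \<and> norm (n s w) \<le> e * (2 * b)"
    if e_pos: "e > 0" for e
  proof -
    obtain r where r: "r > 0"
      "\<And>y z :: real^'n. norm y \<le> r \<Longrightarrow> norm z \<le> r \<Longrightarrow> norm (defect y - defect z) \<le> e * norm (y - z)"
      using defect_lipschitz[OF e_pos] by blast
    have "norm (n s w - n s z) \<le> e * b * norm (w - z) \<and> norm (n s w) \<le> e * (2 * b)"
      if s: "0 < s" "s < r / (2 * b)" and w: "norm w \<le> 1" and z: "norm z \<le> 1" for s w z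
    proof -
      have small: "norm (s *\<^sub>R (B *v (v + y))) \<le> r" if "norm y \<le> 1" for y
      proof -
        have "norm (s *\<^sub>R (B *v (v + y))) \<le> s * (2 * b)"
          using s arg[OF that] by simp
        also have "\<dots> \<le> r"
          using s b by (simp add: field_simps)
        finally show ?thesis .
      qed
      have "norm (n s w - n s z) = (1 / s) * norm (defect (s *\<^sub>R (B *v (v + w))) - defect (s *\<^sub>R (B *v (v + z))))"
        using s by (simp add: n_def scaleR_diff_right[symmetric] del: scaleR_diff_right)
      also have "\<dots> \<le> (1 / s) * (e * norm (s *\<^sub>R (B *v (v + w)) - s *\<^sub>R (B *v (v + z))))"
        using s r(2)[OF small[OF w] small[OF z]] by (intro mult_left_mono) auto
      also have "s *\<^sub>R (B *v (v + w)) - s *\<^sub>R (B *v (v + z)) = s *\<^sub>R (B *v (w - z))"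
        by (simp add: scaleR_diff_right[symmetric] matrix_vector_mult_diff_distrib[symmetric] del: scaleR_diff_right)
      also have "(1 / s) * (e * norm (s *\<^sub>R (B *v (w - z)))) = e * norm (B *v (w - z))"
        using s by simp
      also have "\<dots> \<le> e * (norm (w - z) * b)"
        using b e_pos by simp
      finally have 1: "norm (n s w - n s z) \<le> e * b * norm (w - z)"
        by (simp add: mult_ac)
      have "norm (n s w) = (1 / s) * norm (defect (s *\<^sub>R (B *v (v + w))) - defect 0)"
        using s by (simp add: n_def)
      also have "\<dots> \<le> (1 / s) * (e * norm (s *\<^sub>R (B *v (v + w)) - 0))"
        using s r(1) r(2)[OF small[OF w], of 0] by (intro mult_left_mono) auto
      also have "\<dots> = e * norm (B *v (v + w))"
        using s by simp
      also have "\<dots> \<le> e * (2 * b)"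
        using arg[OF w] e_pos by simp
      finally show ?thesis using 1 by blast
    qed
    then show ?thesis
      using r b by (intro exI[of _ "r / (2 * b)"]) simp
  qed
  \<comment> \<open>\<open>e * b * l \<le> 1 / 12\<close> serves the self-map bound
    \<open>6 * (e * b) * l \<le> 1\<close> and the contraction bound
    \<open>5 * (e * b * l) \<le> 1 / 2\<close>; \<open>e * b \<le> 1 / 4\<close> later gives
    \<open>\<bar>c s\<bar> < 1\<close>.\<close>
  define e where "e = min (1 / (12 * l * b)) (1 / (4 * b))"
  have e: "e > 0" "e * b * l \<le> 1 / 12" "e * b \<le> 1 / 4"
  proof -
    show "e > 0" using l b by (simp add: e_def)
    have "e \<le> 1 / (12 * l * b)" "e \<le> 1 / (4 * b)" by (simp_all add: e_def)
    then show "e * b * l \<le> 1 / 12" "e * b \<le> 1 / 4"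
      using l b by (simp_all add: field_simps)
  qed
  obtain s0 where s0: "s0 > 0"
    and lip: "\<And>s w z. 0 < s \<Longrightarrow> s < s0 \<Longrightarrow> norm w \<le> 1 \<Longrightarrow> norm z \<le> 1 \<Longrightarrow>
      norm (n s w - n s z) \<le> e * b * norm (w - z)"
    and bound: "\<And>s w. 0 < s \<Longrightarrow> s < s0 \<Longrightarrow> norm w \<le> 1 \<Longrightarrow> norm (n s w) \<le> 2 * (e * b)"
    using n_small[OF e(1)] by (metis mult.left_commute)
  define I where "I = {0<..<s0}"
  have maps: "T s w \<in> cball 0 1" if s: "s \<in> I" and w: "w \<in> cball 0 1" for s w
  proof -
    have "norm (n s w) \<le> 2 * (e * b)" and w1: "norm w \<le> 1"
      using bound s w by (auto simp: I_def)
    with vn[of "n s w"] have c: "\<bar>v \<bullet> n s w\<bar> \<le> 2 * (e * b)" by linarith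
    have "norm ((v \<bullet> n s w) *\<^sub>R w - n s w + (v \<bullet> n s w) *\<^sub>R v)
        \<le> \<bar>v \<bullet> n s w\<bar> * norm w + norm (n s w) + \<bar>v \<bullet> n s w\<bar> * norm v"
      by (intro norm_triangle_le norm_triangle_le_diff add_mono) auto
    also have "\<dots> \<le> 2 * (e * b) * 1 + 2 * (e * b) + 2 * (e * b) * 1"
      using c \<open>norm (n s w) \<le> _\<close> w1 v e b by (intro add_mono mult_mono) auto
    finally have "norm ((v \<bullet> n s w) *\<^sub>R w - n s w + (v \<bullet> n s w) *\<^sub>R v) \<le> 6 * (e * b)"
      by (simp add: mult.commute)
    then have "norm ((v \<bullet> n s w) *\<^sub>R w - n s w + (v \<bullet> n s w) *\<^sub>R v) * l \<le> 6 * (e * b) * l"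
      using l by (intro mult_right_mono) auto
    then show ?thesis
      using l(2)[of "(v \<bullet> n s w) *\<^sub>R w - n s w + (v \<bullet> n s w) *\<^sub>R v"] e unfolding T_def by simp
  qed
  have contr: "dist (T s w) (T s z) \<le> (1 / 2) * dist w z"
    if s: "s \<in> I" and w: "w \<in> cball 0 1" and z: "z \<in> cball 0 1" for s w z
  proof -
    define D where "D = e * b * norm (w - z)"
    have nd: "norm (n s w - n s z) \<le> D" and nz: "norm (n s z) \<le> 2 * (e * b)" and w1: "norm w \<le> 1"
      using lip bound s w z by (auto simp: I_def D_def)
    have cz: "\<bar>v \<bullet> n s z\<bar> \<le> 2 * (e * b)" using vn[of "n s z"] nz by linarith
    have cd: "\<bar>v \<bullet> (n s w - n s z)\<bar> \<le> D" using vn[of "n s w - n s z"] nd by linarith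
    \<comment> \<open>The difference of the products of multiplier and point is split as (difference
      of multipliers) times \<open>w\<close> plus (multiplier at \<open>z\<close>) times
      \<open>w - z\<close>.\<close>
    let ?R = "(v \<bullet> (n s w - n s z)) *\<^sub>R w + (v \<bullet> n s z) *\<^sub>R (w - z) - (n s w - n s z)
      + (v \<bullet> (n s w - n s z)) *\<^sub>R v"
    have tri: "norm (p + q - r + t) \<le> norm p + norm q + norm r + norm t" for p q r t :: "real^'n"
      by (intro norm_triangle_le norm_triangle_le_diff add_mono) auto
    have "norm ?R \<le> \<bar>v \<bullet> (n s w - n s z)\<bar> * norm w + \<bar>v \<bullet> n s z\<bar> * norm (w - z)
        + norm (n s w - n s z) + \<bar>v \<bullet> (n s w - n s z)\<bar> * norm v"
      using tri[of "(v \<bullet> (n s w - n s z)) *\<^sub>R w" "(v \<bullet> n s z) *\<^sub>R (w - z)" "n s w - n s z"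
          "(v \<bullet> (n s w - n s z)) *\<^sub>R v"] by simp
    also have "\<dots> \<le> D * 1 + 2 * (e * b) * norm (w - z) + D + D * 1"
      using cd cz nd w1 v e b by (intro add_mono mult_mono) (auto simp: D_def)
    also have "\<dots> = 5 * D"
      by (simp add: D_def)
    finally have R: "norm ?R * l \<le> 5 * D * l"
      using l(1) by (intro mult_right_mono) auto
    have TL: "T s w - T s z = L ?R"
      unfolding T_def linear_diff[OF bounded_linear.linear[OF L], symmetric]
      by (rule arg_cong[of _ _ L]) (simp add: inner_diff_right algebra_simps)
    have "norm (T s w - T s z) \<le> 5 * D * l"
      unfolding TL by (rule order_trans[OF l(2) R])
    also have "\<dots> = 5 * (e * b * l) * norm (w - z)"
      by (simp add: D_def)
    also have "\<dots> \<le> 5 * (1 / 12) * norm (w - z)"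
      using e by (intro mult_right_mono mult_left_mono) auto
    also have "\<dots> \<le> (1 / 2) * norm (w - z)"
      by (intro mult_right_mono) auto
    finally show ?thesis by (simp add: dist_norm)
  qed
  \<comment> \<open>Stated along a moving point, to cover both a frozen \<open>w\<close> and the
    fixed-point curve.\<close>
  have cont_n: "continuous_on I (\<lambda>s. n s (g s))" if "continuous_on I g" for g
    unfolding n_def
    by (intro continuous_intros that bounded_linear.continuous_on[OF matrix_vector_mul_bounded_linear])
      (auto simp: I_def)
  have cont_T: "continuous_on I (\<lambda>s. T s w)" for w
    unfolding T_def
    by (intro bounded_linear.continuous_on[OF L] continuous_intros cont_n)
  obtain g where g: "\<And>s. s \<in> I \<Longrightarrow> g s \<in> cball 0 1 \<and> T s (g s) = g s" and cont_g: "continuous_on I g"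
    using uniform_contraction_continuous_fixpoint[of "cball 0 1" I T] maps contr cont_T
    by (auto simp: complete_eq_closed)
  define c where "c s = v \<bullet> n s (g s)" for s
  define x where "x s = s *\<^sub>R (v + g s)" for s
  define u where "u s = d / (\<mu> - c s)" for s
  have evI: "\<forall>\<^sub>F s in at_right 0. s \<in> I"
    unfolding I_def using s0 by (rule eventually_at_right_real)
  \<comment> \<open>The fixed \<open>e\<close> of the contraction only bounds \<open>c\<close>;
    convergence to 0 comes from \<open>n_small\<close> with arbitrarily small constants.\<close>
  have c_0: "(c \<longlongrightarrow> 0) (at_right 0)"
  proof (rule tendstoI)
    fix a :: real assume "a > 0"
    then have "a / (4 * b) > 0" using b by simp
    from n_small[OF this] obtain s1 where "s1 > 0"
      and s1: "\<And>s w. 0 < s \<Longrightarrow> s < s1 \<Longrightarrow> norm w \<le> 1 \<Longrightarrow> norm (n s w) \<le> a / (4 * b) * (2 * b)"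
      by blast
    show "\<forall>\<^sub>F s in at_right 0. dist (c s) 0 < a"
      using evI eventually_at_right_real[OF \<open>s1 > 0\<close>]
    proof eventually_elim
      case (elim s)
      have "norm (n s (g s)) \<le> a / (4 * b) * (2 * b)"
        using s1[of s "g s"] elim g[of s] by auto
      also have "\<dots> < a"
        using \<open>a > 0\<close> b by simp
      finally show ?case
        using vn[of "n s (g s)"] by (simp add: c_def)
    qed
  qed
  have "((\<lambda>s. \<mu> - c s) \<longlongrightarrow> \<mu> - 0) (at_right 0)"
    by (intro tendsto_intros c_0)
  then have ev_pos: "\<forall>\<^sub>F s in at_right 0. \<mu> - c s > 0"
    using mu_pos by (intro order_tendstoD(1)) auto
  have u_lim: "(u \<longlongrightarrow> d / \<mu>) (at_right 0)"
    unfolding u_def using tendsto_divide[OF tendsto_const \<open>((\<lambda>s. \<mu> - c s) \<longlongrightarrow> \<mu> - 0) (at_right 0)\<close>, of d] mu_pos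
    by simp
  have x_lim: "(x \<longlongrightarrow> 0) (at_right 0)"
  proof (rule Lim_null_comparison)
    show "\<forall>\<^sub>F s in at_right 0. norm (x s) \<le> s * 2"
      using evI
    proof eventually_elim
      case (elim s)
      then have "norm (v + g s) \<le> 2"
        using norm_triangle_ineq[of v "g s"] v g[of s] by simp
      with elim show ?case by (simp add: x_def I_def)
    qed
    show "((\<lambda>s::real. s * 2) \<longlongrightarrow> 0) (at_right 0)"
      by (rule tendsto_eq_intros | simp)+
  qed
  have eq: "\<forall>\<^sub>F s in at_right 0. x s \<noteq> 0 \<and> vector_field (u s) (x s) = 0"
    using evI ev_pos
  proof eventually_elim
    case (elim s)
    then have s: "s > 0" "s < s0" by (auto simp: I_def)
    define w where "w = g s"
    have w: "norm w \<le> 1" and fp: "L (c s *\<^sub>R w - n s w + c s *\<^sub>R v) = w"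
      using g[OF elim(1)] by (auto simp: w_def c_def T_def)
    have Mw: "\<mu> *\<^sub>R w - B *v w + (v \<bullet> w) *\<^sub>R v = c s *\<^sub>R w - n s w + c s *\<^sub>R v"
      using L_inv[of "c s *\<^sub>R w - n s w + c s *\<^sub>R v"] fp by simp
    \<comment> \<open>Orthogonality of \<open>w\<close> to \<open>v\<close> is not imposed on the
      ball but recovered here: pairing the bordered equation with \<open>v\<close> gives
      \<open>v \<bullet> w = c s * (v \<bullet> w)\<close> with \<open>\<bar>c s\<bar> < 1\<close>.
      The bordering term then drops out, and \<open>x s\<close> has component \<open>s\<close> along
      \<open>v\<close>, so it is nonzero.\<close>
    have "v \<bullet> (\<mu> *\<^sub>R w - B *v w + (v \<bullet> w) *\<^sub>R v) = v \<bullet> w"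
      using symmetric_matrix_inner[OF symmetric, of v w] v
      by (simp add: inner_add_right inner_diff_right norm_eq_1)
    moreover have "v \<bullet> (c s *\<^sub>R w - n s w + c s *\<^sub>R v) = c s * (v \<bullet> w)"
      using v by (simp add: inner_add_right inner_diff_right norm_eq_1 c_def w_def)
    ultimately have "v \<bullet> w = c s * (v \<bullet> w)"
      using Mw by simp
    moreover have "\<bar>c s\<bar> < 1"
      using vn[of "n s w"] bound[OF s w] e by (simp add: c_def w_def)
    ultimately have vw: "v \<bullet> w = 0" by auto
    have "v \<bullet> x s = s"
      using vw v by (simp add: x_def w_def inner_add_right norm_eq_1)
    then have "x s \<noteq> 0" using s by auto
    have Bx: "B *v x s = s *\<^sub>R (B *v (v + w))"
      by (simp add: x_def w_def matrix_vector_mult_scaleR)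
    have sn: "s *\<^sub>R n s w = B *v x s - componentwise S (B *v x s)"
      using s by (simp add: n_def Bx defect_def)
    have "n s w = B *v (v + w) - (\<mu> - c s) *\<^sub>R (v + w)"
      using Mw vw v by (simp add: matrix_vector_right_distrib algebra_simps)
    then have "s *\<^sub>R n s w = B *v x s - (\<mu> - c s) *\<^sub>R x s"
      by (simp add: x_def w_def[symmetric] matrix_vector_mult_scaleR scaleR_diff_right mult.commute)
    with sn have "componentwise S (B *v x s) = (\<mu> - c s) *\<^sub>R x s"
      by simp
    then have "vector_field (u s) (x s) = 0"
      using elim by (simp add: vector_field_def u_def)
    with \<open>x s \<noteq> 0\<close> show ?case ..
  qed
  have "continuous_on I x"
    unfolding x_def by (intro continuous_intros cont_g)
  have "continuous_on I c"
    unfolding c_def by (intro continuous_intros cont_n cont_g)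
  have "\<forall>\<^sub>F s in at_right 0. isCont x s \<and> isCont u s"
    using evI ev_pos
  proof eventually_elim
    case (elim s)
    have "open I" by (simp add: I_def)
    then have "isCont x s" "isCont c s"
      using elim \<open>continuous_on I x\<close> \<open>continuous_on I c\<close> continuous_on_eq_continuous_at by blast+
    then show ?case
      unfolding u_def using elim by (auto intro!: continuous_intros)
  qed
  with equilibrium_branchI[OF eq x_lim u_lim] show ?thesis by blast
qed

lemma steady_state_bifurcation:
  "steady_state_bifurcation vector_field (d / \<mu>) (eigenspace B \<mu>)"
proof -
  have "vector_field u 0 = 0" for u
    by (simp add: vector_field_def vec_eq_iff S_0)
  then show ?thesis
    using branch_over_supercritical_parameters continuous_branch
    by (simp add: steady_state_bifurcation_def)
qed

end

section \<open>Transfer to the opinion dynamics\<close>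

text \<open>\<open>1 - deriv S\<close> vanishes at 0, and its derivative has the sign of
  \<open>z\<close>, so the slope is below 1 away from the origin.\<close>

lemma odd_saturating_sublinear_response:
  assumes "odd_saturating S"
  shows "sublinear_response S (deriv S)"
proof
  have S: "\<And>z. S differentiable (at z)" "\<And>z. deriv S differentiable (at z)" "deriv S 0 = 1"
    "\<And>z. sgn (deriv (deriv S) z) = - sgn z"
    using assms by (auto simp: odd_saturating_def)
  show "(S has_real_derivative deriv S z) (at z)" for z
    using S(1) DERIV_deriv_iff_real_differentiable by blast
  show "continuous_on UNIV (deriv S)"
    using S(2) by (intro continuous_at_imp_continuous_on ballI differentiable_imp_continuous_within)
  show "S 0 = 0" "deriv S 0 = 1"
    using assms by (auto simp: odd_saturating_def)
  show "deriv S z < 1" if "z \<noteq> 0" for z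
  proof -
    have "0 < 1 - deriv S z"
    proof (rule DERIV_sgn_imp_pos[where h = "\<lambda>z. 1 - deriv S z" and h' = "\<lambda>z. - deriv (deriv S) z"
          and r = "\<bar>z\<bar> + 1"])
      have "(deriv S has_real_derivative deriv (deriv S) y) (at y)" for y
        using S(2) DERIV_deriv_iff_real_differentiable by blast
      then show "((\<lambda>z. 1 - deriv S z) has_real_derivative - deriv (deriv S) y) (at y)" for y
        by (auto intro!: derivative_eq_intros)
      show "0 < y * - deriv (deriv S) y" if "y \<noteq> 0" for y
      proof -
        have "sgn (y * - deriv (deriv S) y) = sgn y * sgn y"
          using S(4)[of y] by (simp add: sgn_mult sgn_minus)
        also have "\<dots> = 1"
          using that by (simp add: sgn_if)
        finally show ?thesis
          by (simp only: sgn_1_pos)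
      qed
    qed (use S(3) that in auto)
    then show ?thesis by simp
  qed
qed

lemma matrix_vector_mult_affine:
  fixes A :: "real^'n^'n"
  shows "(\<alpha> *\<^sub>R mat 1 + \<gamma> *\<^sub>R A) *v x = \<alpha> *\<^sub>R x + \<gamma> *\<^sub>R (A *v x)"
  by (simp add: matrix_vector_mult_add_rdistrib scaleR_matrix_vector_assoc[symmetric])

text \<open>The factor \<gamma> in \<open>extremal\<close> reverses the inequality when it is
  negative, so in either case \<open>\<alpha> + \<gamma> * l\<close> is the top eigenvalue of
  \<open>B\<close>, with the same eigenspace. The zero diagonal turns the sum over the other agents
  into the full matrix product.\<close>

lemma opinion_steady_state_bifurcation:
  fixes A :: "real^'n^'n"
  assumes sym: "symmetric_matrix A" and diag: "\<And>i. A $ i $ i = 0"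
    and S: "odd_saturating S" and d: "d > 0" and "\<gamma> \<noteq> 0"
    and l: "l \<in> eigenvalues A" and extremal: "\<And>x. \<gamma> * (x \<bullet> (A *v x)) \<le> \<gamma> * (l * (x \<bullet> x))"
    and pos: "\<alpha> + \<gamma> * l > 0"
  shows "steady_state_bifurcation (opinion_field d \<alpha> \<gamma> S A) (d / (\<alpha> + \<gamma> * l)) (eigenspace A l)"
proof -
  define B where "B = \<alpha> *\<^sub>R mat 1 + \<gamma> *\<^sub>R A"
  define \<mu> where "\<mu> = \<alpha> + \<gamma> * l"
  have B: "B *v x = \<alpha> *\<^sub>R x + \<gamma> *\<^sub>R (A *v x)" for x
    by (simp add: B_def matrix_vector_mult_affine)
  have eig: "B *v x = \<mu> *\<^sub>R x \<longleftrightarrow> A *v x = l *\<^sub>R x" for x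
  proof -
    have "B *v x = \<mu> *\<^sub>R x \<longleftrightarrow> \<gamma> *\<^sub>R (A *v x) = \<gamma> *\<^sub>R (l *\<^sub>R x)"
      by (simp add: B \<mu>_def scaleR_add_left)
    then show ?thesis
      using \<open>\<gamma> \<noteq> 0\<close> by (simp only: scaleR_cancel_left) simp
  qed
  interpret sublinear_response S "deriv S"
    using S by (rule odd_saturating_sublinear_response)
  interpret critical_network S "deriv S" B \<mu> d
  proof
    show "symmetric_matrix B"
      using sym by (simp add: symmetric_matrix_def B_def transpose_def mat_def vec_eq_iff)
    show "\<mu> \<in> eigenvalues B"
      using l eig by (simp add: eigenvalues_def)
    show "x \<bullet> (B *v x) \<le> \<mu> * (x \<bullet> x)" for x
      using extremal[of x] by (simp add: B \<mu>_def inner_add_right algebra_simps)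
  qed (use pos d in \<open>simp_all add: \<mu>_def\<close>)
  have "opinion_field d \<alpha> \<gamma> S A = vector_field"
  proof (intro ext)
    fix u x
    have "(\<Sum>k\<in>UNIV - {i}. A $ i $ k * x $ k) = (A *v x) $ i" for i
      using sum.remove[of UNIV i "\<lambda>k. A $ i $ k * x $ k"] diag[of i]
      by (simp add: matrix_vector_mult_def)
    then show "opinion_field d \<alpha> \<gamma> S A u x = vector_field u x"
      by (simp add: opinion_field_def vector_field_def vec_eq_iff B)
  qed
  moreover have "eigenspace B \<mu> = eigenspace A l"
    using eig by (simp add: eigenspace_def)
  ultimately show ?thesis
    using steady_state_bifurcation by (simp add: \<mu>_def)
qed

text \<open>Replaces the limit of distance ratios by an actual eigenspace vector with small relative
  error, so that sign patterns can be compared entrywise.\<close>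

lemma equilibrium_branch_near_eigenspace:
  assumes "equilibrium_branch f u0 (eigenspace A l) x u" and "e > 0"
  shows "\<forall>\<^sub>F s in at_right 0. x s \<noteq> 0 \<and> norm (x s) < e \<and>
    (\<exists>y\<in>eigenspace A l. norm (x s - y) \<le> e * norm (x s))"
proof -
  have "\<forall>\<^sub>F s in at_right 0. (x s, u s) \<in> nonzero_equilibria f"
    and "\<forall>\<^sub>F s in at_right 0. dist (x s) 0 < e"
    and "\<forall>\<^sub>F s in at_right 0. dist (infdist (x s) (eigenspace A l) / norm (x s)) 0 < e"
    using assms by (auto simp: equilibrium_branch_def dest: tendstoD)
  then show ?thesis
  proof eventually_elim
    case (elim s)
    let ?E = "eigenspace A l"
    have "x s \<noteq> 0"
      using elim by (simp add: nonzero_equilibria_def)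
    have "?E \<noteq> {}"
      using subspace_0[OF subspace_eigenspace] by blast
    moreover have "infdist (x s) ?E < e * norm (x s)"
      using elim \<open>x s \<noteq> 0\<close> by (simp add: infdist_nonneg field_simps)
    ultimately have "(INF y\<in>?E. dist (x s) y) < e * norm (x s)"
      by (simp add: infdist_notempty)
    then obtain y where "y \<in> ?E" "dist (x s) y < e * norm (x s)"
      using cInf_lessD[of "dist (x s) ` ?E"] \<open>?E \<noteq> {}\<close> by auto
    then show ?case
      using \<open>x s \<noteq> 0\<close> elim by (auto simp: dist_norm intro!: bexI[of _ y])
  qed
qed

section \<open>Connected regular graphs\<close>

lemma symmetric_adjacency_matrix:
  "simple_graph adj \<Longrightarrow> symmetric_matrix (adjacency_matrix adj)"
  by (auto simp: simple_graph_def symmetric_matrix_def adjacency_matrix_def transpose_def vec_eq_iff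
      dest: sympD)

lemma adjacency_matrix_mult: "(adjacency_matrix adj *v x) $ i = (\<Sum>k | adj i k. x $ k)"
proof -
  have "(adjacency_matrix adj *v x) $ i = (\<Sum>k\<in>UNIV. if adj i k then x $ k else 0)"
    unfolding adjacency_matrix_def matrix_vector_mult_def by (auto intro!: sum.cong)
  also have "\<dots> = (\<Sum>k | adj i k. x $ k)"
    by (simp add: sum.If_cases)
  finally show ?thesis .
qed

lemma regular_graph_eigenvector:
  "regular_graph K adj \<Longrightarrow> adjacency_matrix adj *v (\<chi> i. 1) = real K *\<^sub>R (\<chi> i. 1)"
  by (simp add: vec_eq_iff adjacency_matrix_mult regular_graph_def)

text \<open>A discrete maximum principle: where the entry is maximal, the sum over its
  \<open>K\<close> neighbours is \<open>l\<close> times the maximum, hence at least \<open>K\<close>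
  times it, so every neighbour attains the maximum too. Connectedness spreads this to all
  vertices.\<close>

lemma regular_graph_top_eigenvector_constant:
  assumes conn: "connected_graph adj" and reg: "regular_graph K adj"
    and v: "adjacency_matrix adj *v v = l *\<^sub>R v" and l: "real K \<le> l"
  obtains c where "v = (\<chi> i. c)"
proof -
  \<comment> \<open>Bounding absolute values makes \<open>w $ i\<close> nonnegative, as needed to
    multiply \<open>K \<le> l\<close> by it; one of \<open>v\<close> and \<open>- v\<close> has this
    form.\<close>
  have const: "\<exists>c. w = (\<chi> i. c)"
    if w: "adjacency_matrix adj *v w = l *\<^sub>R w" and max: "\<And>k. \<bar>w $ k\<bar> \<le> w $ i" for w i
  proof -
    have step: "w $ k = w $ i" if "adj j k" "w $ j = w $ i" for j k
    proof -
      have "(\<Sum>k | adj j k. w $ k) = l * w $ i"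
        using arg_cong[OF w, of "\<lambda>x. x $ j"] that by (simp add: adjacency_matrix_mult)
      moreover have "real K * w $ i \<le> l * w $ i"
        using l max[of i] by (intro mult_right_mono) auto
      moreover have "(\<Sum>k | adj j k. w $ i - w $ k) = real K * w $ i - (\<Sum>k | adj j k. w $ k)"
        using reg by (simp add: sum_subtractf regular_graph_def)
      moreover have nn: "w $ i - w $ m \<ge> 0" for m
        using max[of m] by simp
      then have "(\<Sum>k | adj j k. w $ i - w $ k) \<ge> 0"
        by (intro sum_nonneg) auto
      ultimately have "(\<Sum>k | adj j k. w $ i - w $ k) = 0"
        by linarith
      then show ?thesis
        using nn that by (subst (asm) sum_nonneg_eq_0_iff) auto
    qed
    have "w $ k = w $ i" for k
    proof -
      have "adj\<^sup>*\<^sup>* i k" using conn by (simp add: connected_graph_def)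
      then show ?thesis
        by (induction rule: rtranclp_induct) (auto intro: step)
    qed
    then show ?thesis
      by (intro exI[of _ "w $ i"]) (simp add: vec_eq_iff)
  qed
  obtain i where i: "\<And>k. \<bar>v $ k\<bar> \<le> \<bar>v $ i\<bar>"
  proof -
    have "\<exists>i. \<bar>v $ i\<bar> = Max (range (\<lambda>k. \<bar>v $ k\<bar>))"
      using Max_in[of "range (\<lambda>k. \<bar>v $ k\<bar>)"] by (auto simp: image_iff)
    with that show thesis
      by (metis Max_ge finite finite_imageI rangeI)
  qed
  show thesis
  proof (cases "v $ i \<ge> 0")
    case True
    with const[of v i] v i that show thesis by auto
  next
    case False
    have "adjacency_matrix adj *v (- v) = l *\<^sub>R (- v)"
      using v by (metis matrix_vector_mult_scaleR scaleR_minus1_left scaleR_left_commute)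
    with const[of "- v" i] i False obtain c where "- v = (\<chi> i. c)"
      by auto
    then have "v = (\<chi> i. - c)"
      by (auto simp: vec_eq_iff)
    then show thesis by (rule that)
  qed
qed

section \<open>Sign patterns and the conclusion\<close>

text \<open>The deviations from \<open>c\<close> add up to at most a quarter of the norm, so
  comparison with the sum of absolute values forces each one below \<open>\<bar>c\<bar>\<close>, and
  every entry inherits the sign of \<open>c\<close>.\<close>

lemma near_constant_agreement:
  fixes x :: "real^'n"
  assumes "x \<noteq> 0" and near: "norm (x - (\<chi> i. c)) \<le> 1 / (4 * real CARD('n)) * norm x"
  shows "agreement x"
proof -
  define N where "N = real CARD('n)"
  have N: "N \<ge> 1"
    using zero_less_card_finite[where 'a = 'n] by (simp add: N_def)
  have comp: "\<bar>x $ i - c\<bar> \<le> norm x / (4 * N)" for i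
    using component_le_norm_cart[of "x - (\<chi> i. c)" i] near by (simp add: N_def)
  have "norm x \<le> (\<Sum>i\<in>UNIV. \<bar>x $ i\<bar>)"
    by (rule norm_le_l1_cart)
  also have "\<dots> \<le> (\<Sum>i\<in>(UNIV::'n set). \<bar>c\<bar> + norm x / (4 * N))"
    using comp by (intro sum_mono) (smt (verit))
  also have "\<dots> = N * \<bar>c\<bar> + norm x / 4"
    using N by (simp add: N_def field_simps)
  finally have "norm x / (4 * N) \<le> \<bar>c\<bar> / 3" 
    using N by (simp add: field_simps)
  moreover have "norm x / (4 * N) > 0"
    using N assms by simp
  ultimately have close: "\<bar>x $ i - c\<bar> < \<bar>c\<bar>" for i
    using comp[of i] by linarith
  have "x $ i \<noteq> 0 \<and> sgn (x $ i) = sgn c" for i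
    using close[of i] by (auto simp: sgn_if abs_if split: if_splits)
  then show ?thesis
    by (simp add: agreement_def)
qed

text \<open>Without opposite signs the sum of absolute values is the absolute value of the sum,
  which only sees \<open>x - y\<close> and is at most a quarter of the norm of
  \<open>x\<close>.\<close>

lemma near_zero_sum_disagreement:
  fixes x y :: "real^'n"
  assumes "x \<noteq> 0" and y: "(\<Sum>i\<in>UNIV. y $ i) = 0"
    and near: "norm (x - y) \<le> 1 / (4 * real CARD('n)) * norm x"
  shows "disagreement x"
proof (rule ccontr)
  assume "\<not> disagreement x"
  then have "\<not> (x $ i > 0 \<and> x $ k < 0)" for i k
    unfolding disagreement_def by (metis sgn_neg sgn_pos minus_minus zero_neq_one)
  then have "(\<forall>i. x $ i \<ge> 0) \<or> (\<forall>i. x $ i \<le> 0)"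
    by (meson not_le)
  then have "(\<Sum>i\<in>UNIV. \<bar>x $ i\<bar>) = \<bar>\<Sum>i\<in>UNIV. x $ i\<bar>"
  proof
    assume "\<forall>i. x $ i \<le> 0"
    then have "(\<Sum>i\<in>UNIV. \<bar>x $ i\<bar>) = (\<Sum>i\<in>UNIV. - x $ i)" "(\<Sum>i\<in>UNIV. x $ i) \<le> 0"
      by (auto intro!: sum.cong sum_nonpos)
    then show ?thesis by (simp add: sum_negf)
  qed (simp add: sum_nonneg)
  then have "norm x \<le> \<bar>\<Sum>i\<in>UNIV. x $ i\<bar>"
    using norm_le_l1_cart[of x] by simp
  also have "(\<Sum>i\<in>UNIV. x $ i) = (\<Sum>i\<in>UNIV. (x - y) $ i)"
    using y by (simp add: sum_subtractf)
  also have "\<bar>\<Sum>i\<in>UNIV. (x - y) $ i\<bar> \<le> (\<Sum>i\<in>(UNIV::'n set). norm (x - y))"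
    by (intro order_trans[OF sum_abs] sum_mono component_le_norm_cart)
  also have "\<dots> \<le> norm x / 4"
    using near by (simp add: field_simps)
  finally show False
    using \<open>x \<noteq> 0\<close> by simp
qed

theorem theorem2:
  fixes adj :: "'n::finite \<Rightarrow> 'n \<Rightarrow> bool" and K :: nat
    and A :: "real^'n^'n"
    and S :: "real \<Rightarrow> real"
    and d \<alpha> \<gamma> \<theta> :: real
  assumes "CARD('n) \<ge> 2"
    and "simple_graph adj" and "connected_graph adj" and "regular_graph K adj"
    and "A = adjacency_matrix adj"
    and "odd_saturating S"
    and "d > 0" and "\<alpha> \<ge> 0" and "\<theta> > 0"
  shows "(\<gamma> > 0 \<longrightarrow>
            bifurcation_gives_rise_to (opinion_field d \<alpha> \<gamma> S A)
              (d / (\<alpha> + \<gamma> * lambda_max A)) (eigenspace A (lambda_max A)) (consensus \<theta>)) \<and>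
         (\<gamma> < 0 \<longrightarrow>
            bifurcation_gives_rise_to (opinion_field d \<alpha> \<gamma> S A)
              (d / (\<alpha> + \<gamma> * lambda_min A)) (eigenspace A (lambda_min A)) (dissensus \<theta>))"
proof -
  have sym: "symmetric_matrix A"
    using assms by (simp add: symmetric_adjacency_matrix)
  have diag: "A $ i $ i = 0" for i
    using assms by (simp add: adjacency_matrix_def simple_graph_def irreflp_def)
  have ones: "A *v (\<chi> i. 1) = real K *\<^sub>R (\<chi> i. 1)"
    using assms by (simp add: regular_graph_eigenvector)
  obtain i k where edge: "adj i k"
  proof -
    obtain i j :: 'n where "i \<noteq> j"
      using assms(1) by (metis One_nat_def UNIV_I card_1_singleton_iff card_le_Suc0_iff_eq finite not_less_eq_eq numeral_2_eq_2)
    moreover have "adj\<^sup>*\<^sup>* i j"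
      using assms by (simp add: connected_graph_def)
    ultimately show thesis
      using that by (metis converse_rtranclpE)
  qed
  have K: "K > 0"
  proof -
    have "{m. adj i m} \<noteq> {}" using edge by blast
    then have "card {m. adj i m} > 0" by (simp add: card_gt_0_iff)
    then show ?thesis using assms by (simp add: regular_graph_def)
  qed
  have "real K \<in> eigenvalues A"
    using ones by (auto simp: eigenvalues_def vec_eq_iff intro!: exI[of _ "\<chi> i. 1"])
  then have K_le: "real K \<le> lambda_max A"
    unfolding lambda_max_def by (intro Max_ge finite_eigenvalues sym)
  \<comment> \<open>The difference of the basis vectors at the ends of an edge gives the quadratic
    form the value -2. Negativity makes the critical parameter positive and separates this
    eigenvalue from \<open>K\<close>.\<close>
  have min_neg: "lambda_min A < 0"
  proof -
    define z :: "real^'n" where "z = axis i 1 - axis k 1"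
    have "adj k i"
      using edge assms by (auto simp: simple_graph_def dest: sympD)
    then have "A $ i $ k = 1" "A $ k $ i = 1"
      using edge assms by (simp_all add: adjacency_matrix_def)
    then have "z \<bullet> (A *v z) = - 2"
      by (simp add: z_def matrix_vector_mult_diff_distrib matrix_vector_mult_basis column_def
          inner_diff_left inner_axis' diag)
    then have "lambda_min A * (z \<bullet> z) < 0"
      using Rayleigh_min(2)[OF sym, of z] by simp
    then show ?thesis
      using inner_ge_zero[of z] by (auto simp: mult_less_0_iff simp del: inner_ge_zero)
  qed
  \<comment> \<open>With \<open>norm (x s) < \<theta> / 2\<close> any two entries differ by less
    than \<theta>; the other bound is the relative error required by the two sign lemmas.\<close>
  define e where "e = min (\<theta> / 2) (1 / (4 * real CARD('n)))"
  have e: "e > 0" "e \<le> \<theta> / 2" "e \<le> 1 / (4 * real CARD('n))"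
    using \<open>\<theta> > 0\<close> by (auto simp: e_def)
  have near: "norm (x - y) \<le> 1 / (4 * real CARD('n)) * norm x" if "norm (x - y) \<le> e * norm x" for x y :: "real^'n"
    using that mult_right_mono[OF e(3), of "norm x"] by simp
  show ?thesis
  proof (intro conjI impI)
    assume \<gamma>: "\<gamma> > 0"
    have "steady_state_bifurcation (opinion_field d \<alpha> \<gamma> S A)
        (d / (\<alpha> + \<gamma> * lambda_max A)) (eigenspace A (lambda_max A))"
    proof (rule opinion_steady_state_bifurcation)
      show "0 < \<alpha> + \<gamma> * lambda_max A"
        using \<gamma> K K_le \<open>\<alpha> \<ge> 0\<close> by (intro add_nonneg_pos mult_pos_pos) auto
    qed (use sym diag assms \<gamma> Rayleigh_max[OF sym] in auto)
    moreover have "\<forall>\<^sub>F s in at_right 0. consensus \<theta> (x s)"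
      if "equilibrium_branch (opinion_field d \<alpha> \<gamma> S A)
        (d / (\<alpha> + \<gamma> * lambda_max A)) (eigenspace A (lambda_max A)) x u" for x u
      using equilibrium_branch_near_eigenspace[OF that e(1)]
    proof eventually_elim
      case (elim s)
      then obtain y where y: "A *v y = lambda_max A *\<^sub>R y" "norm (x s - y) \<le> e * norm (x s)"
        by (auto simp: eigenspace_def)
      obtain c where "y = (\<chi> i. c)"
        using regular_graph_top_eigenvector_constant[OF assms(3,4)] y(1) K_le assms(5) by metis
      then have "agreement (x s)"
        using near_constant_agreement near[OF y(2)] elim by blast
      moreover have "\<bar>x s $ i - x s $ k\<bar> < \<theta>" for i k
        using component_le_norm_cart[of "x s" i] component_le_norm_cart[of "x s" k] elim e by linarith
      ultimately show ?case
        by (simp add: consensus_def)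
    qed
    ultimately show "bifurcation_gives_rise_to (opinion_field d \<alpha> \<gamma> S A)
        (d / (\<alpha> + \<gamma> * lambda_max A)) (eigenspace A (lambda_max A)) (consensus \<theta>)"
      unfolding bifurcation_gives_rise_to_def by blast
  next
    assume \<gamma>: "\<gamma> < 0"
    have "steady_state_bifurcation (opinion_field d \<alpha> \<gamma> S A)
        (d / (\<alpha> + \<gamma> * lambda_min A)) (eigenspace A (lambda_min A))"
    proof (rule opinion_steady_state_bifurcation)
      show "0 < \<alpha> + \<gamma> * lambda_min A"
        using \<gamma> min_neg \<open>\<alpha> \<ge> 0\<close> by (intro add_nonneg_pos mult_neg_neg) auto
    qed (use sym diag assms \<gamma> Rayleigh_min[OF sym] in auto)
    moreover have "\<forall>\<^sub>F s in at_right 0. dissensus \<theta> (x s)"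
      if "equilibrium_branch (opinion_field d \<alpha> \<gamma> S A)
        (d / (\<alpha> + \<gamma> * lambda_min A)) (eigenspace A (lambda_min A)) x u" for x u
      using equilibrium_branch_near_eigenspace[OF that e(1)]
    proof eventually_elim
      case (elim s)
      then obtain y where y: "A *v y = lambda_min A *\<^sub>R y" "norm (x s - y) \<le> e * norm (x s)"
        by (auto simp: eigenspace_def)
      \<comment> \<open>Eigenvectors for the distinct eigenvalues
        \<open>lambda_min A < 0 < K\<close> are orthogonal, so the entries of \<open>y\<close> sum
        to 0.\<close>
      have "lambda_min A * (y \<bullet> (\<chi> i. 1)) = real K * (y \<bullet> (\<chi> i. 1))"
        using symmetric_matrix_inner[OF sym, of y "\<chi> i. 1"] y(1) ones by simp
      then have "y \<bullet> (\<chi> i. 1) = 0"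
        using min_neg K by auto
      then have "disagreement (x s)"
        using near_zero_sum_disagreement[OF _ _ near[OF y(2)]] elim by (simp add: inner_vec_def)
      moreover have "\<bar>\<Sum>i\<in>UNIV. x s $ i\<bar> < \<theta> * real CARD('n)"
      proof -
        have "\<bar>\<Sum>i\<in>UNIV. x s $ i\<bar> \<le> (\<Sum>i\<in>(UNIV::'n set). norm (x s))"
          by (intro order_trans[OF sum_abs] sum_mono component_le_norm_cart)
        also have "\<dots> = norm (x s) * real CARD('n)"
          by simp
        also have "\<dots> < \<theta> * real CARD('n)"
          using elim e \<open>\<theta> > 0\<close> by (intro mult_strict_right_mono) auto
        finally show ?thesis .
      qed
      ultimately show ?case
        by (simp add: dissensus_def)
    qed
    ultimately show "bifurcation_gives_rise_to (opinion_field d \<alpha> \<gamma> S A)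
        (d / (\<alpha> + \<gamma> * lambda_min A)) (eigenspace A (lambda_min A)) (dissensus \<theta>)"
      unfolding bifurcation_gives_rise_to_def by blast
  qed
qed

end
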